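(* Let $s,t\ge1$, let $\beta_1,\dotsc,\beta_s$ be positive integers, and let \[ F_{\boldsymbol\beta,q}[s;t]=\prod_{1\le i<j\le s}\Big(\frac{z_i}{z_j};q\Big)_{\beta_i}\Big(\frac{qz_j}{z_i};q\Big)_{\beta_j}\prod_{i=1}^s\prod_{j=1}^t\Big(\frac{z_i}{w_j};q\Big)_{\beta_i}^{-1}, \] expanded as a formal series. For $\mathbf{k}=(k_1,\dotsc,k_s)\in\mathbb{Z}^s$ and $\mathbf{m}=(m_1,\dotsc,m_t)\in\mathbb{Z}_{\ge0}^t$, if the monomial $z_1^{k_1}\dotsm z_s^{k_s}w_1^{-m_1}\dotsm w_t^{-m_t}$ appears in the expansion of $F_{\boldsymbol\beta,q}[s;t]$, then $\mathbf{k}^+\ge\mathbf{m}^+$. Moreover, in the case that all $\beta_i$ equal a common positive integer $\beta$, if $\lambda$ is a partition with $s=t=l(\lambda)$, then the coefficient of $z_1^{\lambda_1}\dotsm z_s^{\lambda_s}w_1^{-\lambda_1}\dotsm w_s^{-\lambda_s}$ in $F_{\boldsymbol\beta,q}[s;t]$ is \[ c_\lambda=q^{\beta[l(\lambda)^2-\sum_{i\ge1}m_i(\lambda)^2]/2}\prod_{i\ge1}\frac{(q^\beta;q^\beta)_{m_i(\lambda)}}{(1-q^\beta)^{m_i(\lambda)}}\prod_{i=1}^{l(\lambda)}\frac{(q^\beta;q)_{\lambda_i+(s-i)\beta}}{(q;q)_{\lambda_i+(s-i)\beta}}. \]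
   Context: $(z;q)_n=(1-z)(1-qz)\dotsm(1-q^{n-1}z)$, $(z;q)_0=1$. The expansion is obtained by expanding each factor $(1-q^bz_i/w_j)^{-1}$ as $\sum_{m\ge0}(q^bz_i/w_j)^m$ (the region $|q^bz_i/w_j|<1$). For a partition $\lambda$, $l(\lambda)$ is its number of nonzero parts and $m_i(\lambda)$ the multiplicity of $i$ in $\lambda$. For $a\in\mathbb{Z}^n$, $a^+$ denotes the vector obtained by rearranging $a_1,\dotsc,a_n$ in weakly decreasing order; for $a\in\mathbb{Z}^n$, $b\in\mathbb{Z}^m$, write $a\ge b$ if $a_1+\dotsb+a_i\ge b_1+\dotsb+b_i$ for all $i\ge1$, where vectors are padded with zeros beyond their length. *)

theory Defs
  imports Complex_Main "HOL-Library.Poly_Mapping"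
begin

(* Variables z_0,...,z_{s-1} (Zv i) and w_0,...,w_{t-1} (Wv j); indices are 0-based. *)
datatype var = Zv nat | Wv nat

(* Laurent polynomials in the variables with coefficients in 'a:
   finitely supported maps from integer exponent vectors to coefficients,
   multiplication = convolution. *)
type_synonym 'a lpoly = "(var \<Rightarrow>\<^sub>0 int) \<Rightarrow>\<^sub>0 'a"

definition lconst :: "'a::comm_ring_1 \<Rightarrow> 'a lpoly" where
  "lconst c = Poly_Mapping.single 0 c"

definition ratio :: "var \<Rightarrow> var \<Rightarrow> 'a::comm_ring_1 lpoly" where
  "ratio x y = Poly_Mapping.single (Poly_Mapping.single x 1 + Poly_Mapping.single y (-1)) 1"

definition qpoch :: "'a::comm_ring_1 \<Rightarrow> 'a \<Rightarrow> nat \<Rightarrow> 'a" where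
  "qpoch x q n = (\<Prod>a<n. 1 - q ^ a * x)"

(* Truncation of F_{beta,q}[s;t] (s = length beta): each factor (q^b z_i/w_j)-geometric series
   (1 - q^b z_i/w_j)^{-1} = sum_{n>=0} (q^b z_i/w_j)^n is truncated at degree N. *)
definition F_trunc :: "nat list \<Rightarrow> nat \<Rightarrow> 'a::comm_ring_1 \<Rightarrow> nat \<Rightarrow> 'a lpoly" where
  "F_trunc \<beta> t q N =
     (\<Prod>i<length \<beta>. \<Prod>j\<in>{i<..<length \<beta>}.
        qpoch (ratio (Zv i) (Zv j)) (lconst q) (\<beta> ! i) *
        qpoch (lconst q * ratio (Zv j) (Zv i)) (lconst q) (\<beta> ! j)) *
     (\<Prod>i<length \<beta>. \<Prod>j<t. \<Prod>b<\<beta> ! i.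
        \<Sum>n\<le>N. (lconst (q ^ b) * ratio (Zv i) (Wv j)) ^ n)"

definition expo :: "int list \<Rightarrow> nat list \<Rightarrow> (var \<Rightarrow>\<^sub>0 int)" where
  "expo k m = (\<Sum>i<length k. Poly_Mapping.single (Zv i) (k ! i)) +
              (\<Sum>j<length m. Poly_Mapping.single (Wv j) (- int (m ! j)))"

(* Coefficient of z^k w^{-m} in the formal expansion of F_{beta,q}[s;t]:
   the (eventually constant) coefficient in the truncations as N \<rightarrow> \<infinity>. *)
definition F_coeff :: "nat list \<Rightarrow> nat \<Rightarrow> 'a::comm_ring_1 \<Rightarrow> int list \<Rightarrow> nat list \<Rightarrow> 'a" where
  "F_coeff \<beta> t q k m =
     (THE c. \<forall>\<^sub>F N in sequentially. Poly_Mapping.lookup (F_trunc \<beta> t q N) (expo k m) = c)"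

definition dec_sort :: "'b::linorder list \<Rightarrow> 'b list" where
  "dec_sort a = rev (sort a)"

(* dominance a \<ge> b, vectors padded with zeros *)
definition dominates :: "int list \<Rightarrow> int list \<Rightarrow> bool" where
  "dominates a b \<longleftrightarrow> (\<forall>i. sum_list (take i b) \<le> sum_list (take i a))"

definition is_partition :: "nat list \<Rightarrow> bool" where
  "is_partition la \<longleftrightarrow> sorted (rev la) \<and> (\<forall>x\<in>set la. 0 < x)"

definition mult :: "nat list \<Rightarrow> nat \<Rightarrow> nat" where
  "mult la i = count_list la i"

definition c_lambda :: "nat \<Rightarrow> 'a::field \<Rightarrow> nat list \<Rightarrow> 'a" where
  "c_lambda \<beta> q la =
     (let s = length la in
      q ^ ((\<beta> * (s ^ 2 - (\<Sum>i\<in>set la. mult la i ^ 2))) div 2) *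
      (\<Prod>i\<in>set la. qpoch (q ^ \<beta>) (q ^ \<beta>) (mult la i) / (1 - q ^ \<beta>) ^ mult la i) *
      (\<Prod>i<s. qpoch (q ^ \<beta>) q (la ! i + (s - 1 - i) * \<beta>) /
              qpoch q q (la ! i + (s - 1 - i) * \<beta>)))"

end

(* Expand F in partial fractions in a variable w_j. At the pole w_j = q^b z_i the factors 1 - q^c z_l/w_j
   with l <> i cancel against the Dyson product: what remains is the generating function in the other
   variables, times geometric series in z_i/w_k, times polynomials in the ratios z_i/z_l with nonnegative
   powers. Choosing j with m_j maximal, every contributing monomial has z_i-exponent m_j plus a nonnegative
   amount taken from the other variables, and dominance follows by induction.
   For k = m = lambda, the pole contributes only if lambda_i is maximal, and then only through the constant
   terms of these polynomials, which are powers of q. Summing the residues over b gives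
   (q^beta;q)_n/(q;q)_n with n = lambda_1 + (s-1) beta, and summing over i gives (1 - q^(beta m))/(1 - q^beta)
   for m equal largest parts.
   Partial fractions need q nonzero and not a root of unity; since the coefficients are polynomials in q,
   the remaining q follow. *)
theory Submission
  imports Defs "HOL-Computational_Algebra.Polynomial_FPS"
begin

section \<open>Laurent polynomials\<close>

text \<open>Everything is done coefficientwise in the \<open>w\<close>, inside the Laurent
  polynomials, without rational functions or convergence. The coefficient of \<open>w_j^(-n)\<close>
  in the geometric series is the complete homogeneous polynomial \<open>h_n\<close> of the points
  \<open>a_l = q^b z_i\<close>, and partial fractions become
  \<open>D h_n(a) = sum_l B_l a_l^n\<close>. Interpolation proves this in any integral domain with
  distinct units \<open>a_l\<close>, provided \<open>D\<close> is \<open>B_l\<close> times the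
  product of \<open>1 - a_l'/a_l\<close> over \<open>l' \<noteq> l\<close>. The obstacle is this
  divisibility: the pair factor of \<open>i\<close> and \<open>j\<close> must contain
  \<open>(q^(-b) z_j/z_i; q)\<close> in full length \<open>beta_j\<close> for every
  \<open>b < beta_i\<close>. A pole deletes an arbitrary index \<open>i\<close>, so the induction
  runs over finite index sets. For equal lengths \<open>beta\<close> the constant term of the pair
  quotient is \<open>q^(beta (b+1))\<close> if \<open>i < j\<close> and \<open>q^(beta b)\<close>
  otherwise; this asymmetry makes the sum over equal largest parts geometric.\<close>

text \<open>An arbitrary linear order on the variables makes the ring of Laurent polynomials an instance of \<open>idom\<close>.\<close>
instantiation var :: linorder
begin

definition var_code :: "var \<Rightarrow> nat \<times> bool" where
  "var_code v = (case v of Zv i \<Rightarrow> (i, False) | Wv i \<Rightarrow> (i, True))"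

definition less_eq_var :: "var \<Rightarrow> var \<Rightarrow> bool" where
  "u \<le> v \<longleftrightarrow> fst (var_code u) < fst (var_code v) \<or>
     fst (var_code u) = fst (var_code v) \<and> (snd (var_code u) \<longrightarrow> snd (var_code v))"

definition less_var :: "var \<Rightarrow> var \<Rightarrow> bool" where
  "u < v \<longleftrightarrow> u \<le> v \<and> \<not> v \<le> (u :: var)"

instance
  by standard (auto simp: less_eq_var_def less_var_def var_code_def split: var.splits)

end

abbreviation lookup :: "('k \<Rightarrow>\<^sub>0 'b::zero) \<Rightarrow> 'k \<Rightarrow> 'b" where "lookup \<equiv> Poly_Mapping.lookup"
abbreviation keys :: "('k \<Rightarrow>\<^sub>0 'b::zero) \<Rightarrow> 'k set" where "keys \<equiv> Poly_Mapping.keys"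
abbreviation single :: "'k \<Rightarrow> 'b \<Rightarrow> ('k \<Rightarrow>\<^sub>0 'b::zero)" where "single \<equiv> Poly_Mapping.single"

lemma lookup_mult_group:
  fixes f g :: "'k::ab_group_add \<Rightarrow>\<^sub>0 'b::comm_semiring_0"
  shows "lookup (f * g) x = (\<Sum>l\<in>keys f. lookup f l * lookup g (x - l))"
proof -
  have "x = l + k \<longleftrightarrow> k = x - l" for l k :: 'k by (auto simp: algebra_simps)
  hence "lookup (f * g) x = Sum_any (\<lambda>l. lookup f l * lookup g (x - l))"
    by (simp add: lookup_mult)
  also have "\<dots> = (\<Sum>l\<in>keys f. lookup f l * lookup g (x - l))"
    by (rule Sum_any.expand_superset) (auto simp: in_keys_iff)
  finally show ?thesis .
qed

lemma lookup_mult_unique: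
  fixes f g :: "'k::ab_group_add \<Rightarrow>\<^sub>0 'b::comm_semiring_0"
  assumes "\<And>a. a \<in> keys f \<Longrightarrow> x - a \<in> keys g \<Longrightarrow> a = a0"
  shows "lookup (f * g) x = lookup f a0 * lookup g (x - a0)"
proof -
  have "lookup (f * g) x = (\<Sum>l\<in>keys f. if l = a0 then lookup f l * lookup g (x - l) else 0)"
    unfolding lookup_mult_group
  proof (rule sum.cong)
    fix l assume "l \<in> keys f"
    with assms[of l] show "lookup f l * lookup g (x - l) = (if l = a0 then lookup f l * lookup g (x - l) else 0)"
      by (cases "x - l \<in> keys g") (auto simp: in_keys_iff)
  qed simp
  also have "\<dots> = lookup f a0 * lookup g (x - a0)"
    by (auto simp: sum.delta' in_keys_iff)
  finally show ?thesis .
qed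

lemma lookup_single_mult:
  fixes f :: "'k::ab_group_add \<Rightarrow>\<^sub>0 'b::comm_semiring_0"
  shows "lookup (single k c * f) x = c * lookup f (x - k)"
  by (subst lookup_mult_unique[where ?a0.0 = k]) (auto split: if_splits)

lemma keys_multE:
  assumes "x \<in> keys (f * g)"
  obtains a b where "a \<in> keys f" "b \<in> keys g" "x = a + b"
  using assms keys_mult[of f g] by blast

lemma keys_mult_subset:
  assumes "keys f \<subseteq> S" "keys g \<subseteq> S" "\<And>a b. a \<in> S \<Longrightarrow> b \<in> S \<Longrightarrow> a + b \<in> S"
  shows "keys (f * g) \<subseteq> S"
  using assms by (auto elim!: keys_multE)

text \<open>\<open>S\<close> is an additive submonoid of exponents; later instances are cones and
  spans, which bound supports through arbitrary products.\<close>

lemma keys_prod_subset: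
  fixes f :: "'i \<Rightarrow> 'k::comm_monoid_add \<Rightarrow>\<^sub>0 'b::comm_semiring_1"
  assumes "\<And>i. i \<in> A \<Longrightarrow> keys (f i) \<subseteq> S" "0 \<in> S" "\<And>a b. a \<in> S \<Longrightarrow> b \<in> S \<Longrightarrow> a + b \<in> S"
  shows "keys (prod f A) \<subseteq> S"
proof (cases "finite A")
  case True
  thus ?thesis using assms(1)
  proof (induction A rule: finite_induct)
    case empty
    then show ?case using assms(2) by simp
  next
    case (insert i A)
    then show ?case by (simp add: keys_mult_subset assms(3))
  qed
qed (use assms in simp)

lemma keys_sum_subset:
  assumes "\<And>i. i \<in> A \<Longrightarrow> keys (f i) \<subseteq> S"
  shows "keys (sum f A) \<subseteq> S"
proof (cases "finite A")
  case True
  thus ?thesis using assms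
  proof (induction A rule: finite_induct)
    case (insert i A)
    then show ?case using Poly_Mapping.keys_add[of "f i" "sum f A"] by auto
  qed simp
qed simp

lemma keys_diff_subset:
  fixes f g :: "'k \<Rightarrow>\<^sub>0 'b::ab_group_add"
  assumes "keys f \<subseteq> S" "keys g \<subseteq> S"
  shows "keys (f - g) \<subseteq> S"
  using assms keys_diff[of f g] by blast

definition lmon :: "var \<Rightarrow> int \<Rightarrow> (var \<Rightarrow>\<^sub>0 int)" where "lmon v n = single v n"

lemma lookup_lmon: "lookup (lmon v n) u = (if u = v then n else 0)"
  by (simp add: lmon_def lookup_single when_def)

lemma lconst_mult: "lconst (a * b) = lconst a * lconst b"
  and lconst_one: "lconst 1 = 1"
  and lconst_diff: "lconst (a - b) = lconst a - lconst b"
  and lconst_uminus: "lconst (- a) = - lconst a"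
  by (simp_all add: lconst_def mult_single single_diff single_uminus)

lemma lconst_power: "lconst (a ^ n) = lconst a ^ n"
  by (induction n) (simp_all add: lconst_one lconst_mult)

lemma lconst_prod: "lconst (prod f A) = (\<Prod>i\<in>A. lconst (f i))"
  by (induction A rule: infinite_finite_induct) (simp_all add: lconst_one lconst_mult)

lemma keys_lconst: "keys (lconst a) \<subseteq> {0}"
  by (simp add: lconst_def)

lemma lookup_lconst_mult: "lookup (lconst c * f) x = c * lookup f x"
  by (simp add: lconst_def lookup_single_mult)

lemma ratio_eq: "ratio u v = single (lmon u 1 + lmon v (-1)) 1"
  by (simp add: ratio_def lmon_def)

lemma ratio_swap: "ratio u v * ratio v u = 1"
  by (simp add: ratio_eq mult_single lmon_def poly_mapping_eq_iff lookup_add lookup_single fun_eq_iff when_def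
      flip: single_one)

text \<open>Complete homogeneous symmetric polynomials of the family \<open>a\<close> over \<open>A\<close>,
  read off from the product of the geometric series.\<close>
definition hsym :: "('i \<Rightarrow> 'b::comm_ring_1) \<Rightarrow> 'i set \<Rightarrow> nat \<Rightarrow> 'b" where
  "hsym a A n = fps_nth (\<Prod>l\<in>A. Abs_fps (\<lambda>n. a l ^ n)) n"

lemma hsym_empty: "hsym a {} n = (if n = 0 then 1 else 0)"
  by (simp add: hsym_def)

lemma hsym_insert:
  assumes "finite A" "l \<notin> A"
  shows "hsym a (insert l A) n = (\<Sum>i\<le>n. a l ^ i * hsym a A (n - i))"
  using assms by (simp add: hsym_def fps_mult_nth atLeast0AtMost)

lemma hsym_Un:
  assumes "finite A" "finite B" "A \<inter> B = {}"
  shows "hsym a (A \<union> B) n = (\<Sum>i\<le>n. hsym a A i * hsym a B (n - i))"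
  using assms by (simp add: hsym_def fps_mult_nth atLeast0AtMost prod.union_disjoint)

lemma hsym_0: "finite A \<Longrightarrow> hsym a A 0 = 1"
  by (induction A rule: finite_induct) (simp_all add: hsym_empty hsym_insert)

lemma hsym_reindex: "inj_on f A \<Longrightarrow> hsym a (f ` A) n = hsym (a \<circ> f) A n"
  by (simp add: hsym_def prod.reindex)

lemma fps_one_minus_X_geometric:
  "(1 - fps_const c * fps_X) * Abs_fps (\<lambda>n. c ^ n) = (1 :: 'b::comm_ring_1 fps)"
proof (rule fps_ext)
  fix n
  show "fps_nth ((1 - fps_const c * fps_X) * Abs_fps (\<lambda>n. c ^ n)) n = fps_nth 1 n"
    by (cases n) (simp_all add: left_diff_distrib mult.assoc)
qed

text \<open>Partial fractions for \<open>\<Prod> 1/(1 - a\<^sub>l x)\<close> without denominators: after clearing, both sides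
  are polynomials in \<open>x\<close> of degree less than \<open>|A|\<close> that agree at the points \<open>1/a\<^sub>l\<close>.\<close>
lemma partial_fractions:
  fixes a :: "'i \<Rightarrow> 'b::idom"
  assumes fin: "finite A" and ne: "A \<noteq> {}" and inj: "inj_on a A"
    and inv: "\<And>l. l \<in> A \<Longrightarrow> a l * ai l = 1"
    and D: "\<And>l. l \<in> A \<Longrightarrow> D = B l * (\<Prod>l'\<in>A - {l}. 1 - a l' * ai l)"
  shows "D * hsym a A n = (\<Sum>l\<in>A. B l * a l ^ n)"
proof -
  define p where "p = (\<Sum>l\<in>A. smult (B l) (\<Prod>l'\<in>A - {l}. [:1, - a l':])) - [:D:]"
  have root: "poly p (ai l) = 0" if l: "l \<in> A" for l
  proof -
    have "(\<Sum>k\<in>A. B k * (\<Prod>l'\<in>A - {k}. 1 - a l' * ai l))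
        = (\<Sum>k\<in>A. if k = l then D else 0)"
    proof (rule sum.cong)
      fix k assume k: "k \<in> A"
      show "B k * (\<Prod>l'\<in>A - {k}. 1 - a l' * ai l) = (if k = l then D else 0)"
      proof (cases "k = l")
        \<comment> \<open>The index \<open>l\<close> survives in \<open>A - {k}\<close>, so
          \<open>1 - a l * ai l = 0\<close> is one of the factors.\<close>
        case False
        hence "(\<Prod>l'\<in>A - {k}. 1 - a l' * ai l) = 0"
          using fin l inv[OF l] by (intro prod_zero) auto
        thus ?thesis using False by simp
      qed (use D[OF l] in simp)
    qed simp
    also have "\<dots> = D" using l fin by simp
    finally show ?thesis
      by (simp add: p_def poly_sum poly_prod algebra_simps)
  qed
  have inj_ai: "inj_on ai A"
  proof (rule inj_onI)
    fix x y assume xy: "x \<in> A" "y \<in> A" "ai x = ai y"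
    have "a x = a x * (a y * ai y)" using inv[of y] xy by simp
    also have "\<dots> = (a x * ai x) * a y" using xy by (simp add: ac_simps)
    also have "\<dots> = a y" using inv[of x] xy by simp
    finally show "x = y" using inj xy by (auto dest: inj_onD)
  qed
  \<comment> \<open>The constant \<open>D\<close> has degree 0, which is below \<open>card A\<close>
    because \<open>A\<close> is nonempty.\<close>
  have deg: "degree p < card A"
  proof -
    have "degree (\<Prod>l'\<in>A - {l}. [:1, - a l':]) < card A" if l: "l \<in> A" for l
    proof -
      have "degree (\<Prod>l'\<in>A - {l}. [:1, - a l':]) \<le> (\<Sum>l'\<in>A - {l}. degree [:1, - a l':])"
        by (rule order.trans[OF degree_prod_sum_le]) (use fin in auto)
      also have "\<dots> \<le> (\<Sum>l'\<in>A - {l}. 1)" by (intro sum_mono) simp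
      also have "\<dots> = card A - 1" using fin l by simp
      also have "\<dots> < card A" using fin l by (metis card_gt_0_iff diff_less empty_iff zero_less_one)
      finally show ?thesis .
    qed
    hence "degree (\<Sum>l\<in>A. smult (B l) (\<Prod>l'\<in>A - {l}. [:1, - a l':])) < card A"
      using fin ne by (intro degree_sum_less) (auto intro: le_less_trans[OF degree_smult_le] simp: card_gt_0_iff)
    moreover have "0 < card A" using fin ne by (simp add: card_gt_0_iff)
    ultimately show ?thesis
      unfolding p_def by (intro degree_diff_less) auto
  qed
  have "p = 0"
  proof (rule ccontr)
    assume "p \<noteq> 0"
    have "card A = card (ai ` A)" using inj_ai by (simp add: card_image)
    also have "\<dots> \<le> card {x. poly p x = 0}"
      using \<open>p \<noteq> 0\<close> root by (intro card_mono poly_roots_finite) auto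
    also have "\<dots> \<le> degree p" using \<open>p \<noteq> 0\<close> by (rule card_poly_roots_bound)
    finally show False using deg by simp
  qed
  \<comment> \<open>As power series the linear factors are inverse to the geometric series, so
    multiplying by all the series leaves exactly one of them in each summand.\<close>
  hence "fps_of_poly [:D:] = fps_of_poly (\<Sum>l\<in>A. smult (B l) (\<Prod>l'\<in>A - {l}. [:1, - a l':]))"
    by (simp add: p_def)
  hence D_eq: "fps_const D = (\<Sum>l\<in>A. fps_const (B l) * (\<Prod>l'\<in>A - {l}. 1 - fps_const (a l') * fps_X))"
    by (simp add: fps_of_poly_sum fps_of_poly_smult fps_of_poly_prod fps_of_poly_pCons fps_of_poly_const
        mult.commute fps_const_neg[symmetric] del: fps_const_neg)
  have "fps_const D * (\<Prod>l\<in>A. Abs_fps (\<lambda>n. a l ^ n)) =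
      (\<Sum>l\<in>A. fps_const (B l) * (\<Prod>l'\<in>A - {l}. 1 - fps_const (a l') * fps_X) * (\<Prod>l\<in>A. Abs_fps (\<lambda>n. a l ^ n)))"
    by (simp add: D_eq sum_distrib_right)
  also have "\<dots> = (\<Sum>l\<in>A. fps_const (B l) * Abs_fps (\<lambda>n. a l ^ n))"
  proof (rule sum.cong)
    fix l assume l: "l \<in> A"
    have "(\<Prod>l'\<in>A - {l}. 1 - fps_const (a l') * fps_X) * (\<Prod>l\<in>A. Abs_fps (\<lambda>n. a l ^ n))
        = (\<Prod>l'\<in>A - {l}. (1 - fps_const (a l') * fps_X) * Abs_fps (\<lambda>n. a l' ^ n)) * Abs_fps (\<lambda>n. a l ^ n)"
      by (simp add: prod.remove[OF fin l] prod.distrib)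
    also have "\<dots> = Abs_fps (\<lambda>n. a l ^ n)"
      by (simp add: fps_one_minus_X_geometric)
    finally show "fps_const (B l) * (\<Prod>l'\<in>A - {l}. 1 - fps_const (a l') * fps_X) * (\<Prod>l\<in>A. Abs_fps (\<lambda>n. a l ^ n))
        = fps_const (B l) * Abs_fps (\<lambda>n. a l ^ n)" by (simp add: mult.assoc)
  qed simp
  finally have "fps_nth (fps_const D * (\<Prod>l\<in>A. Abs_fps (\<lambda>n. a l ^ n))) n =
      fps_nth (\<Sum>l\<in>A. fps_const (B l) * Abs_fps (\<lambda>n. a l ^ n)) n" by simp
  thus ?thesis by (simp add: hsym_def fps_sum_nth)
qed

section \<open>The pair factors of the Dyson product at a pole\<close>

lemma qpoch_add: "qpoch x q (m + n) = qpoch x q m * qpoch (q ^ m * x) q n"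
  by (induction n) (simp_all add: qpoch_def power_add ac_simps)

lemma mult_power_inverse:
  fixes q :: "'b::comm_ring_1"
  assumes "q * qi = 1"
  shows "q ^ n * qi ^ n = 1"
  using assms by (metis power_mult_distrib power_one)

text \<open>Factorwise, \<open>1 - q^c u = -q^c u (1 - q^(-c) y)\<close> with \<open>y\<close>
  inverse to \<open>u\<close>. Read backwards, the factors \<open>1 - q^(-c) y\<close> form a
  q-Pochhammer symbol starting at \<open>q^(-(n-1)) y\<close>.\<close>

lemma qpoch_flip:
  assumes q: "q * qi = 1" and u: "u * y = 1"
  shows "qpoch u q n = (\<Prod>c<n. - (q ^ c)) * u ^ n * qpoch (qi ^ (n - 1) * y) q n"
proof -
  have "qpoch (qi ^ (n - 1) * y) q n = (\<Prod>c<n. 1 - q ^ (n - Suc c) * (qi ^ (n - 1) * y))"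
    unfolding qpoch_def by (rule prod.nat_diff_reindex[symmetric])
  also have "\<dots> = (\<Prod>c<n. 1 - qi ^ c * y)"
  proof (rule prod.cong)
    fix c assume "c \<in> {..<n}"
    hence "n - 1 = (n - Suc c) + c" by simp
    hence "q ^ (n - Suc c) * qi ^ (n - 1) = (q ^ (n - Suc c) * qi ^ (n - Suc c)) * qi ^ c"
      by (metis power_add mult.assoc)
    thus "1 - q ^ (n - Suc c) * (qi ^ (n - 1) * y) = 1 - qi ^ c * y"
      by (simp add: mult_power_inverse[OF q] flip: mult.assoc)
  qed simp
  finally have *: "qpoch (qi ^ (n - 1) * y) q n = (\<Prod>c<n. 1 - qi ^ c * y)" .
  have "- (q ^ c) * u * (1 - qi ^ c * y) = 1 - q ^ c * u" for c
  proof -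
    have "- (q ^ c) * u * (1 - qi ^ c * y) = (q ^ c * qi ^ c) * (u * y) - q ^ c * u"
      by (simp add: algebra_simps)
    thus ?thesis by (simp add: mult_power_inverse[OF q] u)
  qed
  hence "qpoch u q n = (\<Prod>c<n. - (q ^ c) * u * (1 - qi ^ c * y))"
    by (simp add: qpoch_def)
  thus ?thesis unfolding * by (simp only: prod.distrib prod_constant card_lessThan)
qed

text \<open>A power of \<open>u\<close> absorbs a symbol in \<open>1/u\<close> and leaves a
  polynomial in \<open>u\<close>; to this \<open>pair_quot\<close> owes its nonnegative
  powers.\<close>

lemma power_mult_qpoch:
  assumes "u * y = 1"
  shows "u ^ n * qpoch (a * y) q n = (\<Prod>c<n. u - q ^ c * a)"
proof -
  have "u * (1 - q ^ c * (a * y)) = u - q ^ c * a" for c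
    using assms by (simp add: algebra_simps) (metis mult.left_commute mult.right_neutral)
  hence "(\<Prod>c<n. u - q ^ c * a) = (\<Prod>c<n. u * (1 - q ^ c * (a * y)))" by simp
  thus ?thesis by (simp only: qpoch_def prod.distrib prod_constant card_lessThan)
qed

text \<open>With \<open>u = z\<^sub>i/z\<^sub>j\<close>, the quotient of the \<open>(i,j)\<close> factor of the Dyson product by
  \<open>(q\<^bsup>-b\<^esup>/u; q)\<close> of length \<open>\<beta>\<^sub>j\<close>; the flag tells whether \<open>i < j\<close>. It involves only nonnegative powers of \<open>u\<close>.\<close>
definition pair_quot :: "bool \<Rightarrow> 'b::comm_ring_1 \<Rightarrow> 'b \<Rightarrow> nat \<Rightarrow> nat \<Rightarrow> nat \<Rightarrow> 'b \<Rightarrow> 'b" where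
  "pair_quot l q qi B1 B2 b u =
     (if l
      then (\<Prod>c<Suc b. - (q ^ c)) * (\<Prod>c<Suc b. u - q ^ c * (q ^ B2 * qi ^ b)) *
        qpoch (q ^ Suc b * u) q (B1 - Suc b)
      else (\<Prod>c<b. - (q ^ c)) * q ^ b * (\<Prod>c<b. u - q ^ c * (q ^ B2 * qi ^ b)) *
        qpoch (q ^ Suc b * u) q (B1 - b))"

text \<open>The first \<open>b + 1\<close> factors of the symbol in \<open>u\<close> flip to factors
  in \<open>y\<close> with exponents \<open>-b, ..., 0\<close> of \<open>q\<close>, which join
  without gap to the exponents \<open>1, ..., B2\<close> of the other symbol. Cutting the joined
  string after \<open>B2\<close> factors leaves the wanted divisor and a tail starting at
  \<open>q^(B2-b) y\<close>, whose \<open>b + 1\<close> factors take up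
  \<open>u^(b+1)\<close>.\<close>

lemma pair_quot_less:
  assumes q: "q * qi = 1" and u: "u * y = 1" and b: "b < B1"
  shows "qpoch u q B1 * qpoch (q * y) q B2 = pair_quot True q qi B1 B2 b u * qpoch (qi ^ b * y) q B2"
proof -
  have "B1 = Suc b + (B1 - Suc b)" using b by simp
  hence 1: "qpoch u q B1 = qpoch u q (Suc b) * qpoch (q ^ Suc b * u) q (B1 - Suc b)"
    by (metis qpoch_add)
  have 2: "qpoch u q (Suc b) = (\<Prod>c<Suc b. - (q ^ c)) * u ^ Suc b * qpoch (qi ^ b * y) q (Suc b)"
    by (subst qpoch_flip[OF q u]) simp
  have "q ^ Suc b * (qi ^ b * y) = q * y"
    using mult_power_inverse[OF q, of b] by (simp flip: mult.assoc add: mult.assoc[of q])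
  hence "qpoch (qi ^ b * y) q (Suc b) * qpoch (q * y) q B2 = qpoch (qi ^ b * y) q (Suc b + B2)"
    by (simp only: qpoch_add)
  also have "\<dots> = qpoch (qi ^ b * y) q B2 * qpoch (q ^ B2 * qi ^ b * y) q (Suc b)"
    by (simp only: add.commute[of "Suc b"] qpoch_add mult.assoc)
  finally have 3: "qpoch (qi ^ b * y) q (Suc b) * qpoch (q * y) q B2
    = qpoch (qi ^ b * y) q B2 * qpoch (q ^ B2 * qi ^ b * y) q (Suc b)" .
  have 4: "u ^ Suc b * qpoch (q ^ B2 * qi ^ b * y) q (Suc b) = (\<Prod>c<Suc b. u - q ^ c * (q ^ B2 * qi ^ b))"
    by (rule power_mult_qpoch[OF u])
  define K R X Y Z W where "K = (\<Prod>c<Suc b. - (q ^ c))" and "R = qpoch (q ^ Suc b * u) q (B1 - Suc b)"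
    and "X = qpoch (qi ^ b * y) q (Suc b)" and "Y = qpoch (q * y) q B2"
    and "Z = qpoch (qi ^ b * y) q B2" and "W = qpoch (q ^ B2 * qi ^ b * y) q (Suc b)"
  have "qpoch u q B1 * qpoch (q * y) q B2 = K * u ^ Suc b * R * (X * Y)"
    unfolding 1 2 K_def R_def X_def Y_def by (simp only: ac_simps)
  also have "\<dots> = K * (u ^ Suc b * W) * R * Z"
    using 3 unfolding X_def[symmetric] Y_def[symmetric] Z_def[symmetric] W_def[symmetric]
    by (simp only: ac_simps)
  finally show ?thesis
    unfolding 4[folded W_def] pair_quot_def K_def R_def Z_def by simp
qed

text \<open>The same regrouping, but the symbol in \<open>y\<close> already starts at exponent 0, so
  only \<open>b\<close> factors of \<open>(q u; q)\<close> are flipped, to exponents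
  \<open>-b, ..., -1\<close>.\<close>

lemma pair_quot_greater:
  assumes q: "q * qi = 1" and u: "u * y = 1" and b: "b < B1"
  shows "qpoch y q B2 * qpoch (q * u) q B1 = pair_quot False q qi B1 B2 b u * qpoch (qi ^ b * y) q B2"
proof -
  have "B1 = b + (B1 - b)" using b by simp
  hence 1: "qpoch (q * u) q B1 = qpoch (q * u) q b * qpoch (q ^ Suc b * u) q (B1 - b)"
    by (metis qpoch_add mult.assoc power_Suc2)
  have qu: "(q * u) * (qi * y) = 1"
    using q u by (metis mult.assoc mult.left_commute mult.right_neutral)
  have 2: "qpoch (q * u) q b = (\<Prod>c<b. - (q ^ c)) * (q ^ b * u ^ b) * qpoch (qi ^ b * y) q b"
  \<comment> \<open>\<open>qi ^ (b - 1) * qi = qi ^ b\<close> is available only for positive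
    \<open>b\<close>, since \<open>b - 1\<close> truncates at 0.\<close>
  proof (cases b)
    case (Suc n)
    show ?thesis
      by (subst qpoch_flip[OF q qu]) (simp add: Suc power_mult_distrib ac_simps)
  qed (simp add: qpoch_def)
  have "q ^ b * (qi ^ b * y) = y"
    using mult_power_inverse[OF q, of b] by (simp flip: mult.assoc)
  hence "qpoch (qi ^ b * y) q b * qpoch y q B2 = qpoch (qi ^ b * y) q (b + B2)"
    by (simp only: qpoch_add)
  also have "\<dots> = qpoch (qi ^ b * y) q B2 * qpoch (q ^ B2 * qi ^ b * y) q b"
    by (simp only: add.commute[of b] qpoch_add mult.assoc)
  finally have 3: "qpoch (qi ^ b * y) q b * qpoch y q B2
    = qpoch (qi ^ b * y) q B2 * qpoch (q ^ B2 * qi ^ b * y) q b" .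
  have 4: "u ^ b * qpoch (q ^ B2 * qi ^ b * y) q b = (\<Prod>c<b. u - q ^ c * (q ^ B2 * qi ^ b))"
    by (rule power_mult_qpoch[OF u])
  define K R X Y Z W where "K = (\<Prod>c<b. - (q ^ c))" and "R = qpoch (q ^ Suc b * u) q (B1 - b)"
    and "X = qpoch (qi ^ b * y) q b" and "Y = qpoch y q B2"
    and "Z = qpoch (qi ^ b * y) q B2" and "W = qpoch (q ^ B2 * qi ^ b * y) q b"
  have "qpoch y q B2 * qpoch (q * u) q B1 = K * q ^ b * u ^ b * R * (X * Y)"
    unfolding 1 2 K_def R_def X_def Y_def by (simp only: ac_simps)
  also have "\<dots> = K * q ^ b * (u ^ b * W) * R * Z"
    using 3 unfolding X_def[symmetric] Y_def[symmetric] Z_def[symmetric] W_def[symmetric]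
    by (simp only: ac_simps)
  finally show ?thesis
    unfolding 4[folded W_def] pair_quot_def K_def R_def Z_def by simp
qed

text \<open>The value of \<open>pair_quot\<close> at \<open>u = 0\<close>.\<close>
lemma pair_quot_const:
  fixes q :: "'b::comm_ring_1"
  assumes q: "q * qi = 1"
  shows "(\<Prod>c<Suc b. - (q ^ c)) * (\<Prod>c<Suc b. - (q ^ c * (q ^ B * qi ^ b))) = q ^ (Suc b * B)"
    and "(\<Prod>c<b. - (q ^ c)) * q ^ b * (\<Prod>c<b. - (q ^ c * (q ^ B * qi ^ b))) = q ^ (b * B)"
proof -
  \<comment> \<open>Reversing one product pairs \<open>q^(n-1-c)\<close> with \<open>q^c\<close>:
    every factor becomes \<open>q^(n-1) x\<close> and the signs cancel.\<close>
  have *: "(\<Prod>c<n. - (q ^ c)) * (\<Prod>c<n. - (q ^ c * x)) = (q ^ (n - 1) * x) ^ n" for n and x :: 'b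
  proof -
    have "(\<Prod>c<n. - (q ^ c)) = (\<Prod>c<n. - (q ^ (n - Suc c)))"
      by (rule prod.nat_diff_reindex[symmetric])
    hence "(\<Prod>c<n. - (q ^ c)) * (\<Prod>c<n. - (q ^ c * x)) = (\<Prod>c<n. q ^ (n - Suc c) * q ^ c * x)"
      by (simp add: ac_simps flip: prod.distrib)
    also have "\<dots> = (\<Prod>c<n. q ^ (n - 1) * x)"
      by (rule prod.cong) (simp_all flip: power_add)
    finally show ?thesis by simp
  qed
  have x: "q ^ n * (q ^ B * qi ^ n) = q ^ B" for n
    using mult_power_inverse[OF q, of n] by (metis mult.left_commute mult.right_neutral)
  show "(\<Prod>c<Suc b. - (q ^ c)) * (\<Prod>c<Suc b. - (q ^ c * (q ^ B * qi ^ b))) = q ^ (Suc b * B)"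
    unfolding * by (simp add: x power_mult[symmetric] mult.commute power_add)
  have "(\<Prod>c<b. - (q ^ c)) * q ^ b * (\<Prod>c<b. - (q ^ c * (q ^ B * qi ^ b)))
      = (q ^ (b - 1) * (q ^ B * qi ^ b)) ^ b * q ^ b"
    unfolding *[symmetric] by (simp only: ac_simps)
  also have "\<dots> = q ^ (b * B)"
  proof (cases b)
    case (Suc n)
    have "(q ^ (b - 1) * (q ^ B * qi ^ b)) ^ b * q ^ b = (q ^ b * (q ^ B * qi ^ b)) ^ b"
      by (simp add: Suc ac_simps flip: power_mult_distrib)
    thus ?thesis unfolding x by (simp add: mult.commute flip: power_mult)
  qed simp
  finally show "(\<Prod>c<b. - (q ^ c)) * q ^ b * (\<Prod>c<b. - (q ^ c * (q ^ B * qi ^ b))) = q ^ (b * B)" .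
qed

section \<open>Cones of exponent vectors and constant terms\<close>

text \<open>For \<open>i\<close> in \<open>I\<close> these are the exponents of products of ratios
  \<open>z_i/z_j\<close> with \<open>j\<close> in \<open>I - {i}\<close>, the only monomials that
  can occur in a pole coefficient.\<close>

definition zcone :: "nat \<Rightarrow> nat set \<Rightarrow> (var \<Rightarrow>\<^sub>0 int) set" where
  "zcone i I = {e. (\<forall>v. v \<notin> Zv ` I \<longrightarrow> lookup e v = 0) \<and> (\<Sum>j\<in>I. lookup e (Zv j)) = 0 \<and>
     (\<forall>j\<in>I - {i}. lookup e (Zv j) \<le> 0)}"

lemma zcone_zero: "0 \<in> zcone i I"
  by (simp add: zcone_def)

lemma zcone_add: "a \<in> zcone i I \<Longrightarrow> b \<in> zcone i I \<Longrightarrow> a + b \<in> zcone i I"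
  by (simp add: zcone_def lookup_add sum.distrib add_nonpos_nonpos)

text \<open>The total is 0 and indices outside \<open>T\<close> contribute nonpositive exponents.
  For dominance this says that a pole coefficient cannot lower a partial sum containing
  \<open>i\<close>.\<close>

lemma zcone_nonneg:
  assumes "finite I" "i \<in> T" "T \<subseteq> I" "e \<in> zcone i I"
  shows "0 \<le> (\<Sum>j\<in>T. lookup e (Zv j))"
proof -
  have "(\<Sum>j\<in>I. lookup e (Zv j)) = (\<Sum>j\<in>T. lookup e (Zv j)) + (\<Sum>j\<in>I - T. lookup e (Zv j))"
    using assms(1,3) by (metis sum.subset_diff add.commute)
  moreover have "(\<Sum>j\<in>I - T. lookup e (Zv j)) \<le> 0"
    using assms by (intro sum_nonpos) (auto simp: zcone_def)
  ultimately show ?thesis using assms(4) by (simp add: zcone_def)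
qed

text \<open>The cone is pointed: if the exponent of \<open>z_i\<close> is not positive, all
  exponents are nonpositive and add up to 0.\<close>

lemma zcone_eq_zeroI:
  assumes "finite I" "i \<in> I" "e \<in> zcone i I" "lookup e (Zv i) \<le> 0"
  shows "e = 0"
proof -
  have "(\<Sum>j\<in>I. - lookup e (Zv j)) = 0"
    using assms(3) by (simp add: zcone_def sum_negf)
  moreover have "0 \<le> - lookup e (Zv j)" if "j \<in> I" for j
    using assms that by (cases "j = i") (auto simp: zcone_def)
  ultimately have "\<forall>j\<in>I. lookup e (Zv j) = 0"
    using assms(1) by (subst (asm) sum_nonneg_eq_0_iff) auto
  hence "lookup e v = 0" for v
    using assms(3) by (cases "v \<in> Zv ` I") (auto simp: zcone_def)
  thus ?thesis by (simp add: poly_mapping_eq_iff fun_eq_iff)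
qed

text \<open>Pointedness makes the constant term multiplicative: two exponents of the cone that
  cancel must both vanish.\<close>

lemma lookup_0_mult_zcone:
  fixes f g :: "'a::comm_ring_1 lpoly"
  assumes "finite I" "i \<in> I" "keys f \<subseteq> zcone i I" "keys g \<subseteq> zcone i I"
  shows "lookup (f * g) 0 = lookup f 0 * lookup g 0"
proof -
  have "a = 0" if "a \<in> keys f" "0 - a \<in> keys g" for a
  proof (rule zcone_eq_zeroI)
    show "a \<in> zcone i I" using assms(3) that by auto
    have "- a \<in> zcone i I" using assms(4) that by auto
    thus "lookup a (Zv i) \<le> 0"
      using zcone_nonneg[of I i "{i}" "- a"] assms(1,2) by simp
  qed (use assms in auto)
  from lookup_mult_unique[of f 0 g 0, OF this] show ?thesis by simp
qed

lemma lookup_0_prod_zcone: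
  fixes f :: "'i \<Rightarrow> 'a::comm_ring_1 lpoly"
  assumes "finite I" "i \<in> I" "\<And>x. x \<in> A \<Longrightarrow> keys (f x) \<subseteq> zcone i I"
  shows "lookup (prod f A) 0 = (\<Prod>x\<in>A. lookup (f x) 0)"
  using assms(3)
proof (induction A rule: infinite_finite_induct)
  case (insert x A)
  have "keys (prod f A) \<subseteq> zcone i I"
    by (rule keys_prod_subset) (use insert in \<open>auto simp: zcone_zero zcone_add\<close>)
  then show ?case
    using insert lookup_0_mult_zcone[OF assms(1,2), of "f x" "prod f A"] by simp
qed (simp_all add: lookup_one)

lemma lookup_lconst_zero: "lookup (lconst c) 0 = c"
  by (simp add: lconst_def)

lemma keys_lconst_zcone: "keys (lconst c) \<subseteq> zcone i I"
  using keys_lconst[of c] zcone_zero by auto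

lemma keys_ratio_zcone:
  assumes "finite I" "i \<in> I" "j \<in> I" "i \<noteq> j"
  shows "keys (ratio (Zv i) (Zv j) :: 'a::comm_ring_1 lpoly) \<subseteq> zcone i I"
proof -
  have "(\<Sum>k\<in>I. (if k = i then 1 else 0) + (if k = j then - 1 else (0::int))) = 0"
    using assms by (subst sum.distrib) simp
  thus ?thesis using assms
    by (auto simp: ratio_eq zcone_def lookup_add lookup_lmon cong: if_cong)
qed

lemma lookup_0_ratio:
  assumes "i \<noteq> j"
  shows "lookup (ratio (Zv i) (Zv j) :: 'a::comm_ring_1 lpoly) 0 = 0"
proof -
  have "lookup (lmon (Zv i) 1 + lmon (Zv j) (-1)) (Zv i) \<noteq> lookup 0 (Zv i)"
    using assms by (simp add: lookup_add lookup_lmon)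
  hence "lmon (Zv i) 1 + lmon (Zv j) (-1) \<noteq> 0" by metis
  thus ?thesis by (simp add: ratio_eq lookup_single when_def)
qed

context
  fixes i j :: nat and I :: "nat set" and q qi :: "'a::comm_ring_1"
  assumes I: "finite I" "i \<in> I" "j \<in> I" "i \<noteq> j"
begin

private lemma keys_linear:
  "keys (ratio (Zv i) (Zv j) - lconst (a :: 'a)) \<subseteq> zcone i I"
  "keys (1 - lconst (a :: 'a) * ratio (Zv i) (Zv j)) \<subseteq> zcone i I"
proof -
  have one: "keys (1 :: 'a lpoly) \<subseteq> zcone i I"
    unfolding lconst_one[symmetric] by (rule keys_lconst_zcone)
  show "keys (ratio (Zv i) (Zv j) - lconst a) \<subseteq> zcone i I"
    by (intro keys_diff_subset keys_ratio_zcone keys_lconst_zcone I)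
  show "keys (1 - lconst a * ratio (Zv i) (Zv j)) \<subseteq> zcone i I"
    by (intro keys_diff_subset keys_mult_subset keys_ratio_zcone keys_lconst_zcone one I zcone_add)
qed

private lemma lookup_linear:
  "lookup (ratio (Zv i) (Zv j) - lconst a) 0 = - a"
  "lookup (1 - lconst a * ratio (Zv i) (Zv j)) 0 = 1"
  using I by (simp_all add: lookup_minus lookup_0_ratio lookup_lconst_mult lookup_lconst_zero)

text \<open>\<open>pair_quot\<close> is a product of scalars and linear factors \<open>u - a\<close>
  and \<open>1 - a u\<close> with \<open>u = z_i/z_j\<close>. Their constant terms are
  \<open>-a\<close> and \<open>1\<close>, so only the scalars of \<open>pair_quot_const\<close>
  remain.\<close>

lemma keys_pair_quot:
  "keys (pair_quot l (lconst q) (lconst qi) B1 B2 b (ratio (Zv i) (Zv j))) \<subseteq> zcone i I" (is ?K)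
  and lookup_0_pair_quot:
  "q * qi = 1 \<Longrightarrow> lookup (pair_quot l (lconst q) (lconst qi) B1 B2 b (ratio (Zv i) (Zv j))) 0
     = q ^ ((if l then Suc b else b) * B2)" (is "_ \<Longrightarrow> ?L")
proof -
  define R where "R n = (\<Prod>c<n. ratio (Zv i) (Zv j) - lconst (q ^ c * (q ^ B2 * qi ^ b)))" for n
  define Q where "Q n = qpoch (lconst (q ^ Suc b) * ratio (Zv i) (Zv j)) (lconst q) n" for n
  define K where "K = (if l then (\<Prod>c<Suc b. - (q ^ c)) else (\<Prod>c<b. - (q ^ c)) * q ^ b)"
  define n where "n = (if l then Suc b else b)"
  have eq: "pair_quot l (lconst q) (lconst qi) B1 B2 b (ratio (Zv i) (Zv j)) = lconst K * R n * Q (B1 - n)"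
    by (simp add: pair_quot_def K_def n_def R_def Q_def lconst_mult lconst_power lconst_prod lconst_uminus)
  have Q_eq: "Q n = (\<Prod>c<n. 1 - lconst (q ^ c * q ^ Suc b) * ratio (Zv i) (Zv j))" for n
    by (simp add: Q_def qpoch_def lconst_mult lconst_power mult.assoc)
  have kR: "keys (R n) \<subseteq> zcone i I" and kQ: "keys (Q n) \<subseteq> zcone i I" for n
    unfolding R_def Q_eq by (intro keys_prod_subset keys_linear zcone_zero zcone_add; assumption)+
  have kKR: "keys (lconst K * R n) \<subseteq> zcone i I"
    by (intro keys_mult_subset kR keys_lconst_zcone zcone_add)
  show ?K unfolding eq by (intro keys_mult_subset kKR kQ zcone_add)
  have "lookup (lconst K * R n * Q (B1 - n)) 0 = K * lookup (R n) 0 * lookup (Q (B1 - n)) 0"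
    by (simp add: lookup_0_mult_zcone[OF I(1,2) kKR kQ] lookup_lconst_mult)
  also have "lookup (R n) 0 = (\<Prod>c<n. - (q ^ c * (q ^ B2 * qi ^ b)))"
    unfolding R_def by (subst lookup_0_prod_zcone[OF I(1,2) keys_linear(1)]) (simp add: lookup_linear)
  also have "lookup (Q (B1 - n)) 0 = 1"
    unfolding Q_eq by (subst lookup_0_prod_zcone[OF I(1,2) keys_linear(2)]) (simp add: lookup_linear)
  finally show "q * qi = 1 \<Longrightarrow> ?L"
    unfolding eq using pair_quot_const[of q qi b B2] by (auto simp: K_def n_def)
qed

end

section \<open>Partial fraction expansion of the generating function\<close>

definition dyson_pair :: "(nat \<Rightarrow> nat) \<Rightarrow> 'a::comm_ring_1 \<Rightarrow> nat \<Rightarrow> nat \<Rightarrow> 'a lpoly" where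
  "dyson_pair B q i j =
     qpoch (ratio (Zv i) (Zv j)) (lconst q) (B i) *
     qpoch (lconst q * ratio (Zv j) (Zv i)) (lconst q) (B j)"

text \<open>Taken over a set of indices and not an initial segment, since poles delete arbitrary
  indices; the remaining pairs keep their orientation.\<close>

definition dyson :: "(nat \<Rightarrow> nat) \<Rightarrow> 'a::comm_ring_1 \<Rightarrow> nat set \<Rightarrow> 'a lpoly" where
  "dyson B q I = (\<Prod>i\<in>I. \<Prod>j\<in>{j\<in>I. i < j}. dyson_pair B q i j)"

lemma dyson_insert:
  assumes "finite I" "i \<notin> I"
  shows "dyson B q (insert i I) =
    dyson B q I * (\<Prod>j\<in>I. if i < j then dyson_pair B q i j else dyson_pair B q j i)"
proof -
  have 1: "{j \<in> insert i I. i < j} = {j \<in> I. i < j}" by auto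
  have 2: "(\<Prod>j\<in>{j \<in> insert i I. k < j}. dyson_pair B q k j)
      = (if k < i then dyson_pair B q k i else 1) * (\<Prod>j\<in>{j \<in> I. k < j}. dyson_pair B q k j)"
    if "k \<in> I" for k
  proof -
    have "{j \<in> insert i I. k < j} = (if k < i then insert i {j \<in> I. k < j} else {j \<in> I. k < j})" by auto
    thus ?thesis using assms by simp
  qed
  have 3: "(\<Prod>j\<in>{j \<in> I. i < j}. dyson_pair B q i j) = (\<Prod>j\<in>I. if i < j then dyson_pair B q i j else 1)"
    using assms by (simp add: prod.If_cases Int_def)
  have "dyson B q (insert i I) = (\<Prod>j\<in>I. if i < j then dyson_pair B q i j else 1) *
     ((\<Prod>k\<in>I. if k < i then dyson_pair B q k i else 1) * dyson B q I)"
    unfolding dyson_def prod.insert[OF assms] 1 3 by (simp add: 2 prod.distrib cong: prod.cong del: insert_iff)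
  also have "\<dots> = dyson B q I * (\<Prod>j\<in>I. (if i < j then dyson_pair B q i j else 1) * (if j < i then dyson_pair B q j i else 1))"
    by (simp only: prod.distrib ac_simps)
  also have "(\<Prod>j\<in>I. (if i < j then dyson_pair B q i j else 1) * (if j < i then dyson_pair B q j i else 1))
     = (\<Prod>j\<in>I. if i < j then dyson_pair B q i j else dyson_pair B q j i)"
    by (rule prod.cong) (use assms in \<open>auto simp: not_less le_less\<close>)
  finally show ?thesis .
qed

section \<open>Poles and residues of the generating function\<close>

definition generic :: "'a::field \<Rightarrow> bool" where
  "generic q \<longleftrightarrow> q \<noteq> 0 \<and> (\<forall>n\<ge>1. q ^ n \<noteq> 1)"

lemma generic_power_inj:
  assumes "generic q" "q ^ m = q ^ n"
  shows "m = n"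
proof -
  have *: False if "a < b" "q ^ a = q ^ b" for a b
  proof -
    have "q ^ a * q ^ (b - a) = q ^ (a + (b - a))" by (rule power_add[symmetric])
    also have "\<dots> = q ^ a * 1" using that by simp
    finally have "q ^ a * q ^ (b - a) = q ^ a * 1" .
    hence "q ^ (b - a) = 1" using assms(1) by (subst (asm) mult_cancel_left) (auto simp: generic_def)
    thus False using assms(1) that(1) by (simp add: generic_def)
  qed
  show ?thesis using *[of m n] *[of n m] assms(2) by (metis linorder_neqE_nat)
qed

text \<open>The point \<open>q^b z_i\<close> for \<open>l = (i, b)\<close>, a pole in each
  \<open>w_j\<close>.\<close>

definition node :: "'a::comm_ring_1 \<Rightarrow> nat \<times> nat \<Rightarrow> 'a lpoly" where
  "node q l = single (lmon (Zv (fst l)) 1) (q ^ snd l)"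

definition node_inv :: "'a::comm_ring_1 \<Rightarrow> nat \<times> nat \<Rightarrow> 'a lpoly" where
  "node_inv qi l = single (lmon (Zv (fst l)) (-1)) (qi ^ snd l)"

definition nodes :: "(nat \<Rightarrow> nat) \<Rightarrow> nat set \<Rightarrow> (nat \<times> nat) set" where
  "nodes B I = Sigma I (\<lambda>i. {..<B i})"

lemma lmon_add: "lmon v m + lmon v n = lmon v (m + n)"
  by (simp add: lmon_def single_add)

lemma lmon_0: "lmon v 0 = 0"
  by (simp add: lmon_def)

lemma node_mult_inv: "q * qi = 1 \<Longrightarrow> node q l * node_inv qi l = 1"
  by (simp add: node_def node_inv_def mult_single lmon_add lmon_0 mult_power_inverse)

lemma node_power: "node q (i, b) ^ n = single (lmon (Zv i) (int n)) (q ^ (b * n))"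
  by (induction n) (simp_all add: lmon_0 node_def mult_single lmon_add power_add algebra_simps)

lemma node_inj:
  assumes "generic q"
  shows "inj (node q)"
proof (rule injI)
  fix l l' assume *: "node q l = node q l'"
  obtain i b i' b' where l: "l = (i, b)" "l' = (i', b')" by (metis surj_pair)
  have nz: "q ^ b \<noteq> 0" "q ^ b' \<noteq> 0" using assms by (simp_all add: generic_def)
  have "keys (node q l) = keys (node q l')" using * by simp
  hence "lmon (Zv i) 1 = lmon (Zv i') 1" using nz by (simp add: node_def l del: power_eq_0_iff)
  hence "lookup (lmon (Zv i) 1) (Zv i) = lookup (lmon (Zv i') 1) (Zv i)" by simp
  hence i: "i = i'" by (simp add: lookup_lmon split: if_splits)
  have "q ^ b = q ^ b'" using * by (simp add: node_def l i) (metis lookup_single_eq)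
  thus "l = l'" using generic_power_inj[OF assms] i l by simp
qed

lemma node_quotient: "node q (j, c) * node_inv qi (i, b) = lconst (q ^ c * qi ^ b) * ratio (Zv j) (Zv i)"
  by (simp add: node_def node_inv_def lconst_def ratio_eq mult_single)

lemma node_quotient_same: "node q (i, c) * node_inv qi (i, b) = lconst (q ^ c * qi ^ b)"
  by (simp add: node_def node_inv_def lconst_def mult_single lmon_add lmon_0)

text \<open>The partial fraction coefficient of
  \<open>1/((1 - x)(1 - q x)...(1 - q^(n-1) x))\<close> at the pole
  \<open>x = q^(-b)\<close>.\<close>

definition node_wt :: "'a::field \<Rightarrow> nat \<Rightarrow> nat \<Rightarrow> 'a" where
  "node_wt q n b = inverse (\<Prod>c\<in>{..<n} - {b}. 1 - q ^ c * inverse q ^ b)"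

lemma node_wt:
  assumes "generic q"
  shows "node_wt q n b * (\<Prod>c\<in>{..<n} - {b}. 1 - q ^ c * inverse q ^ b) = 1"
proof -
  have q: "q * inverse q = 1" "q \<noteq> 0" using assms by (auto simp: generic_def)
  have "1 - q ^ c * inverse q ^ b \<noteq> 0" if "c \<noteq> b" for c
  proof
    assume "1 - q ^ c * inverse q ^ b = 0"
    hence "q ^ b = q ^ c" using q(2) by (simp add: field_simps)
    thus False using generic_power_inj[OF assms] that by metis
  qed
  thus ?thesis unfolding node_wt_def by (intro left_inverse) (auto simp: prod_zero_iff)
qed

definition pole_coeff :: "(nat \<Rightarrow> nat) \<Rightarrow> 'a::field \<Rightarrow> nat set \<Rightarrow> nat \<Rightarrow> nat \<Rightarrow> 'a lpoly" where
  "pole_coeff B q I i b =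
     (\<Prod>j\<in>I - {i}. pair_quot (i < j) (lconst q) (lconst (inverse q)) (B i) (B j) b (ratio (Zv i) (Zv j)))"

text \<open>The divisibility that partial fractions ask for. Nodes with the same \<open>i\<close>
  give the scalar inverted by \<open>node_wt\<close>; those of an index \<open>j \<noteq> i\<close>
  give \<open>(q^(-b) z_j/z_i; q)\<close> of length \<open>B j\<close>, the divisor in
  \<open>pair_quot_less\<close> and \<open>pair_quot_greater\<close>.\<close>

lemma dyson_at_node:
  assumes q: "generic q" and fin: "finite I" and l: "(i, b) \<in> nodes B I"
  shows "dyson B q I = lconst (node_wt q (B i) b) * pole_coeff B q I i b * dyson B q (I - {i}) *
    (\<Prod>l\<in>nodes B I - {(i, b)}. 1 - node q l * node_inv (inverse q) (i, b))"
proof -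
  let ?qi = "inverse q"
  have i: "i \<in> I" and b: "b < B i" using l by (auto simp: nodes_def)
  have q1: "q * ?qi = 1" using q by (simp add: generic_def)
  have lq: "lconst q * lconst ?qi = 1" using q1 by (metis lconst_mult lconst_one)
  have set: "nodes B I - {(i, b)} = ({i} \<times> ({..<B i} - {b})) \<union> nodes B (I - {i})"
    using i by (auto simp: nodes_def)
  have "(\<Prod>l\<in>nodes B I - {(i, b)}. 1 - node q l * node_inv ?qi (i, b))
     = (\<Prod>l\<in>{i} \<times> ({..<B i} - {b}). 1 - node q l * node_inv ?qi (i, b)) *
       (\<Prod>l\<in>nodes B (I - {i}). 1 - node q l * node_inv ?qi (i, b))"
    unfolding set by (rule prod.union_disjoint) (use fin in \<open>auto simp: nodes_def\<close>)
  also have "(\<Prod>l\<in>{i} \<times> ({..<B i} - {b}). 1 - node q l * node_inv ?qi (i, b))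
      = (\<Prod>i'\<in>{i}. \<Prod>c\<in>{..<B i} - {b}. 1 - node q (i', c) * node_inv ?qi (i, b))"
    by (subst prod.cartesian_product) (simp add: case_prod_unfold)
  also have "\<dots> = lconst (\<Prod>c\<in>{..<B i} - {b}. 1 - q ^ c * ?qi ^ b)"
    by (simp add: node_quotient_same lconst_prod lconst_diff lconst_one)
  also have "(\<Prod>l\<in>nodes B (I - {i}). 1 - node q l * node_inv ?qi (i, b))
      = (\<Prod>j\<in>I - {i}. \<Prod>c<B j. 1 - node q (j, c) * node_inv ?qi (i, b))"
    unfolding nodes_def using fin by (subst prod.Sigma) (simp_all add: case_prod_unfold)
  also have "\<dots> = (\<Prod>j\<in>I - {i}. qpoch (lconst ?qi ^ b * ratio (Zv j) (Zv i)) (lconst q) (B j))"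
    by (simp add: qpoch_def node_quotient lconst_mult lconst_power mult.assoc)
  finally have prod_eq: "(\<Prod>l\<in>nodes B I - {(i, b)}. 1 - node q l * node_inv ?qi (i, b))
    = lconst (\<Prod>c\<in>{..<B i} - {b}. 1 - q ^ c * ?qi ^ b) *
      (\<Prod>j\<in>I - {i}. qpoch (lconst ?qi ^ b * ratio (Zv j) (Zv i)) (lconst q) (B j))" .
  have "(if i < j then dyson_pair B q i j else dyson_pair B q j i)
     = pair_quot (i < j) (lconst q) (lconst ?qi) (B i) (B j) b (ratio (Zv i) (Zv j)) *
       qpoch (lconst ?qi ^ b * ratio (Zv j) (Zv i)) (lconst q) (B j)" for j
    using pair_quot_less[OF lq ratio_swap[of "Zv i" "Zv j"] b, of "B j"]
      pair_quot_greater[OF lq ratio_swap[of "Zv i" "Zv j"] b, of "B j"]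
    by (auto simp: dyson_pair_def)
  hence "dyson B q I = dyson B q (I - {i}) * (pole_coeff B q I i b *
      (\<Prod>j\<in>I - {i}. qpoch (lconst ?qi ^ b * ratio (Zv j) (Zv i)) (lconst q) (B j)))"
    using dyson_insert[of "I - {i}" i B q] fin i
    by (simp add: insert_absorb pole_coeff_def prod.distrib)
  also have "\<dots> = lconst (node_wt q (B i) b * (\<Prod>c\<in>{..<B i} - {b}. 1 - q ^ c * ?qi ^ b)) * \<dots>"
    unfolding node_wt[OF q] by (simp add: lconst_one)
  finally show ?thesis unfolding prod_eq lconst_mult by (simp only: ac_simps)
qed

text \<open>The coefficient of \<open>\<Prod> w\<^sub>j\<^bsup>-m\<^sub>j\<^esup>\<close> in the generating function, as a Laurent polynomial in the \<open>z\<^sub>i\<close>.\<close>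
definition wcoeff :: "(nat \<Rightarrow> nat) \<Rightarrow> 'a::comm_ring_1 \<Rightarrow> nat set \<Rightarrow> nat set \<Rightarrow> (nat \<Rightarrow> nat) \<Rightarrow> 'a lpoly" where
  "wcoeff B q I J m = dyson B q I * (\<Prod>j\<in>J. hsym (node q) (nodes B I) (m j))"

lemma finite_nodes: "finite I \<Longrightarrow> finite (nodes B I)"
  by (simp add: nodes_def)

lemma dyson_hsym:
  assumes q: "generic q" and fin: "finite I" and ne: "nodes B I \<noteq> {}"
  shows "dyson B q I * hsym (node q) (nodes B I) n =
    (\<Sum>(i, b)\<in>nodes B I. single (lmon (Zv i) (int n)) (q ^ (b * n) * node_wt q (B i) b) *
      (pole_coeff B q I i b * dyson B q (I - {i})))"
proof -
  have q1: "q * inverse q = 1" using q by (simp add: generic_def)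
  have "dyson B q I * hsym (node q) (nodes B I) n =
    (\<Sum>l\<in>nodes B I. lconst (node_wt q (B (fst l)) (snd l)) * pole_coeff B q I (fst l) (snd l) *
       dyson B q (I - {fst l}) * node q l ^ n)"
  proof (rule partial_fractions[where ai = "node_inv (inverse q)"])
    show "inj_on (node q) (nodes B I)" using node_inj[OF q] by (rule inj_on_subset) simp
    show "node q l * node_inv (inverse q) l = 1" for l by (rule node_mult_inv[OF q1])
    show "dyson B q I = lconst (node_wt q (B (fst l)) (snd l)) * pole_coeff B q I (fst l) (snd l) *
       dyson B q (I - {fst l}) * (\<Prod>l'\<in>nodes B I - {l}. 1 - node q l' * node_inv (inverse q) l)"
      if "l \<in> nodes B I" for l
      using dyson_at_node[OF q fin, of "fst l" "snd l" B] that by simp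
  qed (use fin ne finite_nodes in auto)
  also have "\<dots> = (\<Sum>(i, b)\<in>nodes B I. single (lmon (Zv i) (int n)) (q ^ (b * n) * node_wt q (B i) b) *
      (pole_coeff B q I i b * dyson B q (I - {i})))"
  proof (rule sum.cong, simp, clarify)
    fix i b
    have *: "lconst (node_wt q (B i) b) * node q (i, b) ^ n
        = single (lmon (Zv i) (int n)) (q ^ (b * n) * node_wt q (B i) b)"
      by (simp add: node_power lconst_def mult_single mult.commute)
    show "lconst (node_wt q (B (fst (i, b))) (snd (i, b))) * pole_coeff B q I (fst (i, b)) (snd (i, b)) *
       dyson B q (I - {fst (i, b)}) * node q (i, b) ^ n =
      single (lmon (Zv i) (int n)) (q ^ (b * n) * node_wt q (B i) b) * (pole_coeff B q I i b * dyson B q (I - {i}))"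
      unfolding *[symmetric] by (simp add: ac_simps)
  qed
  finally show ?thesis .
qed

lemma hsym_node_single:
  "finite C \<Longrightarrow> hsym (\<lambda>b. node q (i, b)) C n = single (lmon (Zv i) (int n)) (hsym (\<lambda>b. q ^ b) C n)"
proof (induction C arbitrary: n rule: finite_induct)
  case empty
  show ?case by (simp add: hsym_empty lmon_0)
next
  case (insert b C)
  have "lmon (Zv i) (int k) + lmon (Zv i) (int (n - k)) = lmon (Zv i) (int n)" if "k \<le> n" for k
    using that by (simp add: lmon_add)
  moreover have "(\<Sum>k\<in>K. single e (g k)) = single e (sum g K)" for K :: "nat set" and g :: "nat \<Rightarrow> 'a" and e :: "var \<Rightarrow>\<^sub>0 int"
    by (induction K rule: infinite_finite_induct) (simp_all add: single_add)
  ultimately show ?case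
    using insert by (simp add: hsym_insert node_power mult_single flip: power_mult)
qed

lemma hsym_nodes_remove:
  assumes "finite I" "i \<in> I"
  shows "hsym (node q) (nodes B I) n =
    (\<Sum>e\<le>n. single (lmon (Zv i) (int e)) (hsym (\<lambda>b. q ^ b) {..<B i} e) * hsym (node q) (nodes B (I - {i})) (n - e))"
proof -
  have "nodes B I = (Pair i ` {..<B i}) \<union> nodes B (I - {i})"
    using assms by (auto simp: nodes_def)
  moreover have "hsym (node q) (Pair i ` {..<B i}) e = single (lmon (Zv i) (int e)) (hsym (\<lambda>b. q ^ b) {..<B i} e)" for e
    by (subst hsym_reindex) (simp_all add: inj_on_def o_def hsym_node_single)
  ultimately show ?thesis
    using assms by (simp add: hsym_Un finite_nodes) (subst hsym_Un, auto simp: finite_nodes nodes_def)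
qed

lemma prod_single:
  fixes c :: "'i \<Rightarrow> 'a::comm_ring_1"
  shows "(\<Prod>j\<in>J. single (k j) (c j)) = single (sum k J) (prod c J)"
  by (induction J rule: infinite_finite_induct) (simp_all add: mult_single)

lemma sum_lmon: "(\<Sum>j\<in>J. lmon v (f j)) = lmon v (sum f J)"
  by (induction J rule: infinite_finite_induct) (simp_all add: lmon_add lmon_0)

text \<open>\<open>e j\<close> is the part of the exponent of \<open>w_j\<close> taken up by the
  geometric series in \<open>z_i/w_j\<close>; it moves into the exponent of \<open>z_i\<close>, and
  the smaller generating function supplies the rest \<open>m j - e j\<close>.\<close>

theorem wcoeff_expand:
  assumes q: "generic q" and I: "finite I" "nodes B I \<noteq> {}" and J: "finite J" "j0 \<in> J"
  shows "wcoeff B q I J m = (\<Sum>(i, b)\<in>nodes B I. \<Sum>e\<in>PiE (J - {j0}) (\<lambda>j. {..m j}).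
    single (lmon (Zv i) (int (m j0 + sum e (J - {j0}))))
      (q ^ (b * m j0) * node_wt q (B i) b * (\<Prod>j\<in>J - {j0}. hsym (\<lambda>b. q ^ b) {..<B i} (e j))) *
    (pole_coeff B q I i b * wcoeff B q (I - {i}) (J - {j0}) (\<lambda>j. m j - e j)))"
proof -
  define h where "h i e = hsym (\<lambda>b. q ^ b) {..<B i} e" for i e
  have "wcoeff B q I J m = (dyson B q I * hsym (node q) (nodes B I) (m j0)) *
     (\<Prod>j\<in>J - {j0}. hsym (node q) (nodes B I) (m j))"
    unfolding wcoeff_def using J by (simp add: prod.remove mult.assoc)
  also have "\<dots> = (\<Sum>(i, b)\<in>nodes B I. single (lmon (Zv i) (int (m j0))) (q ^ (b * m j0) * node_wt q (B i) b) *
      (pole_coeff B q I i b * dyson B q (I - {i})) * (\<Prod>j\<in>J - {j0}. hsym (node q) (nodes B I) (m j)))"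
    unfolding dyson_hsym[OF q I] by (simp add: sum_distrib_right case_prod_unfold)
  also have "\<dots> = (\<Sum>(i, b)\<in>nodes B I. \<Sum>e\<in>PiE (J - {j0}) (\<lambda>j. {..m j}).
    single (lmon (Zv i) (int (m j0 + sum e (J - {j0}))))
      (q ^ (b * m j0) * node_wt q (B i) b * (\<Prod>j\<in>J - {j0}. h i (e j))) *
    (pole_coeff B q I i b * wcoeff B q (I - {i}) (J - {j0}) (\<lambda>j. m j - e j)))"
  proof (rule sum.cong, simp, clarify)
    fix i b assume "(i, b) \<in> nodes B I"
    hence i: "i \<in> I" by (simp add: nodes_def)
    have "(\<Prod>j\<in>J - {j0}. hsym (node q) (nodes B I) (m j)) =
      (\<Prod>j\<in>J - {j0}. \<Sum>e\<in>{..m j}. single (lmon (Zv i) (int e)) (h i e) * hsym (node q) (nodes B (I - {i})) (m j - e))"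
      by (simp add: hsym_nodes_remove[OF I(1) i] h_def)
    also have "\<dots> = (\<Sum>e\<in>PiE (J - {j0}) (\<lambda>j. {..m j}). \<Prod>j\<in>J - {j0}.
        single (lmon (Zv i) (int (e j))) (h i (e j)) * hsym (node q) (nodes B (I - {i})) (m j - e j))"
      by (rule prod_sum_PiE) (use J in auto)
    also have "\<dots> = (\<Sum>e\<in>PiE (J - {j0}) (\<lambda>j. {..m j}).
        single (lmon (Zv i) (int (sum e (J - {j0})))) (\<Prod>j\<in>J - {j0}. h i (e j)) *
        (\<Prod>j\<in>J - {j0}. hsym (node q) (nodes B (I - {i})) (m j - e j)))"
      by (simp add: prod.distrib prod_single sum_lmon)
    finally have *: "(\<Prod>j\<in>J - {j0}. hsym (node q) (nodes B I) (m j)) = \<dots>" .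
    have s: "single (lmon (Zv i) (int (m j0))) c * single (lmon (Zv i) (int n)) d
        = single (lmon (Zv i) (int (m j0 + n))) (c * d)" for c d :: 'a and n
      by (simp add: mult_single lmon_add)
    show "single (lmon (Zv i) (int (m j0))) (q ^ (b * m j0) * node_wt q (B i) b) *
      (pole_coeff B q I i b * dyson B q (I - {i})) * (\<Prod>j\<in>J - {j0}. hsym (node q) (nodes B I) (m j)) =
      (\<Sum>e\<in>PiE (J - {j0}) (\<lambda>j. {..m j}).
    single (lmon (Zv i) (int (m j0 + sum e (J - {j0}))))
      (q ^ (b * m j0) * node_wt q (B i) b * (\<Prod>j\<in>J - {j0}. h i (e j))) *
    (pole_coeff B q I i b * wcoeff B q (I - {i}) (J - {j0}) (\<lambda>j. m j - e j)))"
      unfolding * sum_distrib_left s[symmetric] wcoeff_def by (simp only: ac_simps)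
  qed
  finally show ?thesis unfolding h_def .
qed

section \<open>Dominance\<close>

definition zspan :: "nat set \<Rightarrow> (var \<Rightarrow>\<^sub>0 int) set" where
  "zspan I = {e. \<forall>v. v \<notin> Zv ` I \<longrightarrow> lookup e v = 0}"

lemma zspan_zero: "0 \<in> zspan I"
  by (simp add: zspan_def)

lemma zspan_add: "a \<in> zspan I \<Longrightarrow> b \<in> zspan I \<Longrightarrow> a + b \<in> zspan I"
  by (simp add: zspan_def lookup_add)

lemma keys_hsym_subset:
  fixes a :: "'i \<Rightarrow> 'k::comm_monoid_add \<Rightarrow>\<^sub>0 'b::comm_ring_1"
  assumes "finite A" "\<And>l. l \<in> A \<Longrightarrow> keys (a l) \<subseteq> S" "0 \<in> S" "\<And>x y. x \<in> S \<Longrightarrow> y \<in> S \<Longrightarrow> x + y \<in> S"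
  shows "keys (hsym a A n) \<subseteq> S"
  using assms(1,2)
proof (induction A arbitrary: n rule: finite_induct)
  case empty
  then show ?case using assms(3) by (simp add: hsym_empty)
next
  case (insert l A)
  have "keys (a l ^ i) \<subseteq> S" for i
    using keys_prod_subset[of "{..<i}" "\<lambda>_. a l" S] insert.prems assms(3,4) by simp
  then show ?case
    using insert by (simp add: hsym_insert keys_sum_subset keys_mult_subset assms(4))
qed

lemma keys_dyson:
  assumes "finite I"
  shows "keys (dyson B q I) \<subseteq> {e \<in> zspan I. (\<Sum>j\<in>I. lookup e (Zv j)) = 0}" (is "_ \<subseteq> ?S")
proof -
  have add: "a + b \<in> ?S" if "a \<in> ?S" "b \<in> ?S" for a b
    using that by (simp add: zspan_add lookup_add sum.distrib)
  have z: "0 \<in> ?S" by (simp add: zspan_zero)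
  have cone: "zcone i I \<subseteq> ?S" for i by (auto simp: zcone_def zspan_def)
  have c: "keys (lconst c) \<subseteq> ?S" for c :: 'a
    using keys_lconst_zcone[of c 0 I] cone by blast
  have r: "keys (ratio (Zv i) (Zv j) :: 'a lpoly) \<subseteq> ?S" if "i \<in> I" "j \<in> I" "i \<noteq> j" for i j
    using keys_ratio_zcone[OF assms that] cone by blast
  have p: "keys (qpoch x (lconst q) n) \<subseteq> ?S" if "keys x \<subseteq> ?S" for x :: "'a lpoly" and n
    unfolding qpoch_def lconst_power[symmetric] lconst_one[symmetric]
    by (intro keys_prod_subset keys_diff_subset keys_mult_subset c that z add)
  show ?thesis
    unfolding dyson_def dyson_pair_def
    by (intro keys_prod_subset keys_mult_subset p c r z add) auto
qed

lemma keys_node: "l \<in> nodes B I \<Longrightarrow> keys (node q l) \<subseteq> zspan I"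
  by (auto simp: node_def nodes_def zspan_def lookup_lmon split: if_splits)

lemma keys_wcoeff:
  assumes "finite I"
  shows "keys (wcoeff B q I J m) \<subseteq> zspan I"
  unfolding wcoeff_def using keys_dyson[OF assms, of B q]
  by (intro keys_mult_subset keys_prod_subset keys_hsym_subset keys_node finite_nodes assms zspan_zero zspan_add) auto

lemma keys_pole_coeff:
  assumes "finite I" "i \<in> I"
  shows "keys (pole_coeff B q I i b) \<subseteq> zcone i I"
  unfolding pole_coeff_def
  by (intro keys_prod_subset keys_pair_quot assms zcone_zero zcone_add) auto

text \<open>Each pair contributes \<open>q^(n b)\<close>, and one more \<open>q^n\<close> if
  \<open>i < j\<close>, where \<open>b + 1\<close> factors were flipped. The number of larger
  indices later becomes the exponent in the geometric sum over equal largest parts.\<close>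

lemma lookup_0_pole_coeff:
  assumes "finite I" "i \<in> I" "q \<noteq> 0"
  shows "lookup (pole_coeff (\<lambda>_. n) q I i b) 0 = q ^ (n * (b * (card I - 1) + card {j \<in> I. i < j}))"
proof -
  have "lookup (pole_coeff (\<lambda>_. n) q I i b) 0 = (\<Prod>j\<in>I - {i}. q ^ ((if i < j then Suc b else b) * n))"
    unfolding pole_coeff_def
    by (subst lookup_0_prod_zcone[OF assms(1,2)], rule keys_pair_quot)
      (use assms in \<open>auto intro!: prod.cong simp: lookup_0_pair_quot[OF assms(1,2)]\<close>)
  also have "\<dots> = q ^ (\<Sum>j\<in>I - {i}. (if i < j then Suc b else b) * n)"
    by (simp add: power_sum)
  also have "(\<Sum>j\<in>I - {i}. (if i < j then Suc b else b) * n) = (\<Sum>j\<in>I - {i}. n * b + n * (if i < j then 1 else 0))"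
    by (rule sum.cong) auto
  also have "\<dots> = n * (b * (card I - 1) + card {j \<in> I. i < j})"
  proof -
    have "{j \<in> I - {i}. i < j} = {j \<in> I. i < j}" by auto
    hence "(\<Sum>j\<in>I - {i}. if i < j then 1 else 0) = card {j \<in> I. i < j}"
      using assms(1) by (simp add: sum.If_cases Int_def)
    thus ?thesis using assms by (simp add: sum.distrib algebra_simps flip: sum_distrib_left)
  qed
  finally show ?thesis .
qed

text \<open>Removing a nonpositive entry does not lower the sum; if there is none, any entry may
  go.\<close>

lemma subset_sum_nonneg:
  fixes k :: "'i \<Rightarrow> int"
  assumes "finite I" "0 \<le> sum k I" "r \<le> card I"
  shows "\<exists>T\<subseteq>I. card T = r \<and> 0 \<le> sum k T"
  using assms(3)
proof (induction r rule: inc_induct)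
  case base
  show ?case using assms(2) by blast
next
  case (step r)
  then obtain T where T: "T \<subseteq> I" "card T = Suc r" "0 \<le> sum k T" by blast
  have fin: "finite T" using T(1) assms(1) by (rule finite_subset)
  have "\<exists>x\<in>T. 0 \<le> sum k (T - {x})"
  proof (cases "\<exists>x\<in>T. k x \<le> 0")
    case True
    then obtain x where "x \<in> T" "k x \<le> 0" by blast
    thus ?thesis using T(3) fin by (auto simp: sum_diff1 intro!: bexI[of _ x])
  next
    case False
    moreover obtain x where "x \<in> T" using T(2) by fastforce
    ultimately show ?thesis by (intro bexI[of _ x] sum_nonneg) auto
  qed
  then obtain x where "x \<in> T" "0 \<le> sum k (T - {x})" by blast
  thus ?case using T fin by (intro exI[of _ "T - {x}"]) auto
qed

text \<open>Dominance in terms of subsets, free of sorting. The size of \<open>T\<close> is exact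
  because entries of \<open>k\<close> may be negative; \<open>S\<close> only obeys a bound, so that
  \<open>r\<close> may exceed \<open>card J\<close>.\<close>

lemma wcoeff_dominates:
  assumes "generic q" "finite I" "finite J" "k \<in> keys (wcoeff B q I J m)" "\<forall>i\<in>I. 0 < B i"
    "S \<subseteq> J" "card S \<le> r"
  shows "\<exists>T\<subseteq>I. card T = min r (card I) \<and> (\<Sum>j\<in>S. int (m j)) \<le> (\<Sum>i\<in>T. lookup k (Zv i))"
  using assms(2-)
proof (induction "card J" arbitrary: I J m k S r)
  case 0
  hence J: "J = {}" "S = {}" by auto
  have "(\<Sum>i\<in>I. lookup k (Zv i)) = 0"
    using 0 keys_dyson[of I B q] by (auto simp: wcoeff_def J)
  then show ?case
    using subset_sum_nonneg[of I "\<lambda>i. lookup k (Zv i)" "min r (card I)"] 0 J by auto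
next
  case (Suc N)
  show ?case
  proof (cases "I = {}")
    case True
    \<comment> \<open>Without \<open>z\<close> variables the generating function is 1, so every
      \<open>m j\<close> must vanish.\<close>
    have "m j = 0" if "j \<in> J" for j
    proof (rule ccontr)
      assume "m j \<noteq> 0"
      hence "wcoeff B q I J m = 0"
        using that Suc.prems(2) by (auto simp: wcoeff_def True nodes_def hsym_empty intro!: bexI[of _ j])
      thus False using Suc.prems(3) by simp
    qed
    thus ?thesis using True Suc.prems(5) by (auto simp: subset_iff)
  next
    case I: False
    show ?thesis
    proof (cases "r = 0")
      case True
      hence "S = {}" using Suc.prems finite_subset[of S J] by auto
      thus ?thesis using True by auto
    next
      case r: False
      have "nodes B I \<noteq> {}" using I Suc.prems(4) by (auto simp: nodes_def)
      note nodes = this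
      have "m ` J \<noteq> {}" "finite (m ` J)" using Suc.hyps(2) Suc.prems(2) by auto
      then obtain j0 where j0: "j0 \<in> J" "m j0 = Max (m ` J)" by (metis Max_in imageE)
      hence max: "m j \<le> m j0" if "j \<in> J" for j using that Suc.prems(2) by simp
      let ?J = "J - {j0}"
      from Suc.prems(3)[unfolded wcoeff_expand[OF assms(1) Suc.prems(1) nodes Suc.prems(2) j0(1)]]
      obtain i b e where ibe: "(i, b) \<in> nodes B I" "e \<in> PiE ?J (\<lambda>j. {..m j})"
        and k: "k \<in> keys (single (lmon (Zv i) (int (m j0 + sum e ?J)))
          (q ^ (b * m j0) * node_wt q (B i) b * (\<Prod>j\<in>?J. hsym (\<lambda>b. q ^ b) {..<B i} (e j))) *
          (pole_coeff B q I i b * wcoeff B q (I - {i}) ?J (\<lambda>j. m j - e j)))"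
        by (fastforce dest!: subsetD[OF keys_sum])
      from k obtain c k' where c: "c \<in> keys (pole_coeff B q I i b)"
        and k': "k' \<in> keys (wcoeff B q (I - {i}) ?J (\<lambda>j. m j - e j))"
        and k: "k = lmon (Zv i) (int (m j0 + sum e ?J)) + (c + k')"
        by (auto elim!: keys_multE split: if_splits)
      have i: "i \<in> I" using ibe by (simp add: nodes_def)
      have c: "c \<in> zcone i I" using c keys_pole_coeff[OF Suc.prems(1) i] by blast
      have k'i: "lookup k' (Zv i) = 0"
        using k' keys_wcoeff[of "I - {i}" B q ?J] Suc.prems(1) by (fastforce simp: zspan_def)
      have e: "e j \<le> m j" if "j \<in> ?J" for j using ibe(2) that by (auto simp: PiE_def)
      \<comment> \<open>If \<open>j0\<close> lies in \<open>S\<close>, remove it; otherwise remove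
        any element, whose value is at most \<open>m j0\<close> by the choice of
        \<open>j0\<close>.\<close>
      have "\<exists>S'\<subseteq>?J. card S' \<le> r - 1 \<and> (\<Sum>j\<in>S. int (m j)) \<le> int (m j0) + (\<Sum>j\<in>S'. int (m j))"
      proof (cases "S = {}")
        case False
        have finS: "finite S" using Suc.prems finite_subset by blast
        obtain s where s: "s \<in> S" "j0 \<in> S \<longrightarrow> s = j0" using False by blast
        hence "(\<Sum>j\<in>S. int (m j)) = int (m s) + (\<Sum>j\<in>S - {s}. int (m j))"
          using finS by (simp add: sum.remove)
        moreover have "m s \<le> m j0" using max s Suc.prems(5) by blast
        ultimately show ?thesis
          using s Suc.prems(5,6) finS by (intro exI[of _ "S - {s}"]) auto
      qed auto
      then obtain S' where S': "S' \<subseteq> ?J" "card S' \<le> r - 1"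
        "(\<Sum>j\<in>S. int (m j)) \<le> int (m j0) + (\<Sum>j\<in>S'. int (m j))" by blast
      have "\<exists>T\<subseteq>I - {i}. card T = min (r - 1) (card (I - {i})) \<and>
          (\<Sum>j\<in>S'. int (m j - e j)) \<le> (\<Sum>i\<in>T. lookup k' (Zv i))"
        by (rule Suc.hyps(1)) (use Suc.hyps(2) Suc.prems S' j0 k' in auto)
      then obtain T where T: "T \<subseteq> I - {i}" "card T = min (r - 1) (card (I - {i}))"
        "(\<Sum>j\<in>S'. int (m j - e j)) \<le> (\<Sum>i\<in>T. lookup k' (Zv i))" by blast
      have finT: "finite T" "i \<notin> T" using T(1) Suc.prems(1) finite_subset by blast+
      have card: "card (insert i T) = min r (card I)"
        using finT T(2) r i Suc.prems(1) by (simp add: min_def card_Diff_singleton) (use card_gt_0_iff[of I] I Suc.prems(1) in linarith)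
      have kT: "lookup k (Zv j) = lookup c (Zv j) + lookup k' (Zv j)" if "j \<in> T" for j
        using that finT(2) by (auto simp: k lookup_add lookup_lmon)
      have ki: "lookup k (Zv i) = int (m j0) + (\<Sum>j\<in>?J. int (e j)) + lookup c (Zv i)"
        by (simp add: k lookup_add lookup_lmon k'i)
      \<comment> \<open>What the entries in \<open>S'\<close> lose to \<open>e\<close> is regained
        in the exponent of \<open>z_i\<close>, which collects \<open>e\<close> over all of
        \<open>?J\<close>.\<close>
      have "(\<Sum>j\<in>insert i T. lookup k (Zv j)) = int (m j0) + (\<Sum>j\<in>?J. int (e j)) +
          (\<Sum>j\<in>insert i T. lookup c (Zv j)) + (\<Sum>j\<in>T. lookup k' (Zv j))"
        using finT by (simp add: kT ki sum.distrib)
      moreover have "0 \<le> (\<Sum>j\<in>insert i T. lookup c (Zv j))"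
        using T(1) i by (intro zcone_nonneg[OF Suc.prems(1) _ _ c]) auto
      moreover have "(\<Sum>j\<in>S'. int (m j)) = (\<Sum>j\<in>S'. int (m j - e j)) + (\<Sum>j\<in>S'. int (e j))"
        unfolding sum.distrib[symmetric] by (rule sum.cong) (use e S'(1) in \<open>auto simp: of_nat_diff subset_iff\<close>)
      moreover have "(\<Sum>j\<in>S'. int (e j)) \<le> (\<Sum>j\<in>?J. int (e j))"
        using S'(1) Suc.prems(2) by (intro sum_mono2) auto
      ultimately have "(\<Sum>j\<in>S. int (m j)) \<le> (\<Sum>j\<in>insert i T. lookup k (Zv j))"
        using S'(3) T(3) by linarith
      thus ?thesis using card T(1) i by (intro exI[of _ "insert i T"]) auto
    qed
  qed
qed

section \<open>The coefficient indexed by a partition\<close>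

lemma hsym_insert_Suc:
  assumes "finite A" "l \<notin> A"
  shows "hsym a (insert l A) (Suc n) = hsym a A (Suc n) + a l * hsym a (insert l A) n"
  using assms by (simp add: hsym_insert sum.atMost_Suc_shift sum_distrib_left mult.assoc del: sum.atMost_Suc)

text \<open>\<open>h_n(1, q, ..., q^(N-1))\<close> is a Gaussian binomial coefficient, stated here
  without division. The induction step rests on
  \<open>(1 - q^N) + q^N (1 - q^(n+1)) = 1 - q^(N+n+1)\<close>.\<close>

lemma hsym_powers_qpoch:
  fixes q :: "'b::comm_ring_1"
  shows "hsym (\<lambda>b. q ^ b) {..<N} n * qpoch q q n = qpoch (q ^ N) q n"
proof (induction N arbitrary: n)
  case 0
  show ?case by (cases n) (simp_all add: hsym_empty qpoch_def prod.lessThan_Suc_shift del: prod.lessThan_Suc)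
next
  case (Suc N)
  note outer = Suc.IH
  show ?case
  proof (induction n)
    case 0
    show ?case by (simp add: qpoch_def hsym_0)
  next
    case (Suc n)
    let ?P = "qpoch (q ^ Suc N) q n"
    have 1: "qpoch q q (Suc n) = qpoch q q n * (1 - q ^ Suc n)" by (simp add: qpoch_def mult.commute)
    have 2: "qpoch (q ^ N) q (Suc n) = (1 - q ^ N) * ?P"
      using qpoch_add[of "q ^ N" q 1 n] by (simp add: qpoch_def)
    have 3: "qpoch (q ^ Suc N) q (Suc n) = ?P * (1 - q ^ n * q ^ Suc N)" by (simp add: qpoch_def)
    have "hsym (\<lambda>b. q ^ b) {..<Suc N} (Suc n) * qpoch q q (Suc n)
       = hsym (\<lambda>b. q ^ b) {..<N} (Suc n) * qpoch q q (Suc n) +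
         q ^ N * (1 - q ^ Suc n) * (hsym (\<lambda>b. q ^ b) {..<Suc N} n * qpoch q q n)"
      unfolding lessThan_Suc by (subst hsym_insert_Suc) (simp_all add: 1 algebra_simps)
    also have "\<dots> = (1 - q ^ N) * ?P + q ^ N * (1 - q ^ Suc n) * ?P"
      unfolding Suc.IH outer 2 by simp
    also have "\<dots> = qpoch (q ^ Suc N) q (Suc n)"
      unfolding 3 by (simp add: algebra_simps)
    finally show ?case .
  qed
qed

lemma qpoch_generic_nonzero:
  assumes "\<forall>n\<ge>1. q ^ n \<noteq> (1 :: 'a::field)"
  shows "qpoch q q n \<noteq> 0"
proof -
  have "1 - q ^ a * q \<noteq> 0" for a using assms[rule_format, of "Suc a"] by (simp add: mult.commute)
  thus ?thesis by (simp add: qpoch_def)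
qed

text \<open>Partial fractions with \<open>D = 1\<close> at the points \<open>q^b\<close>, read
  backwards: the weighted power sum is \<open>h_n(1, q, ..., q^(N-1))\<close>.\<close>

lemma sum_node_wt:
  assumes q: "generic q" and N: "0 < N"
  shows "(\<Sum>b<N. q ^ (b * n) * node_wt q N b) = qpoch (q ^ N) q n / qpoch q q n"
proof -
  have "1 * hsym (\<lambda>b. q ^ b) {..<N} n = (\<Sum>b<N. node_wt q N b * (q ^ b) ^ n)"
  proof (rule partial_fractions[where ai = "\<lambda>b. inverse q ^ b"])
    show "inj_on (\<lambda>b. q ^ b) {..<N}" using generic_power_inj[OF q] by (auto simp: inj_on_def)
    show "q ^ b * inverse q ^ b = 1" for b
      using q by (intro mult_power_inverse) (simp add: generic_def)
  qed (use N node_wt[OF q] in auto)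
  hence "(\<Sum>b<N. q ^ (b * n) * node_wt q N b) = hsym (\<lambda>b. q ^ b) {..<N} n"
    by (simp add: power_mult mult.commute)
  also have "\<dots> = qpoch (q ^ N) q n / qpoch q q n"
    using hsym_powers_qpoch[of q N n] qpoch_generic_nonzero[of q n] q
    by (simp add: generic_def nonzero_eq_divide_eq)
  finally show ?thesis .
qed

lemma sum_power_card_greater:
  fixes x :: "'b::comm_semiring_1" and A :: "nat set"
  assumes "finite A"
  shows "(\<Sum>i\<in>A. x ^ card {j \<in> A. i < j}) = (\<Sum>p<card A. x ^ p)"
  using assms
proof (induction A rule: finite_linorder_min_induct)
  case (insert i A)
  have "{j \<in> insert i A. i < j} = A" using insert by auto
  moreover have "{j \<in> insert i A. k < j} = {j \<in> A. k < j}" if "k \<in> A" for k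
    using insert that by force
  moreover have "i \<notin> A" using insert by blast
  ultimately show ?case using insert by (simp add: add.commute cong: sum.cong)
qed simp

text \<open>Keeps the natural-number subtraction in the exponent of \<open>c_lambda\<close> from
  truncating.\<close>

lemma sum_mult_squared_le: "(\<Sum>i\<in>set la. (Defs.mult la i)\<^sup>2) \<le> (length la)\<^sup>2"
proof -
  have "(\<Sum>i\<in>set la. (Defs.mult la i)\<^sup>2) \<le> (\<Sum>i\<in>set la. Defs.mult la i * length la)"
    by (intro sum_mono) (simp add: Defs.mult_def power2_eq_square count_le_length)
  also have "\<dots> = (length la)\<^sup>2"
    by (simp add: Defs.mult_def sum_count_set power2_eq_square flip: sum_distrib_right)
  finally show ?thesis .
qed

text \<open>The recursion that the residues will reproduce. With \<open>M\<close> the multiplicity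
  of \<open>x\<close> in \<open>la\<close> and \<open>s\<close> the length of \<open>la\<close>, the
  difference of squares grows by \<open>(2 s + 1) - (2 M + 1) = 2 (s - M)\<close>, an even number,
  so \<open>div 2\<close> splits exactly; the factor of \<open>x\<close> gains
  \<open>(1 - Q^(M+1))/(1 - Q)\<close> with \<open>Q = q^b\<close>.\<close>

lemma c_lambda_Cons:
  fixes q :: "'a::field"
  assumes Q: "q ^ b \<noteq> 1"
  shows "c_lambda b q (x # la) =
    q ^ (b * (length la - count_list la x)) * (\<Sum>p<Suc (count_list la x). (q ^ b) ^ p) *
    (qpoch (q ^ b) q (x + length la * b) / qpoch q q (x + length la * b)) * c_lambda b q la"
proof -
  define M s S where "M = count_list la x" and "s = length la" and "S = insert x (set la)"
  define Q' where "Q' = q ^ b"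
  have finS: "finite S" "x \<in> S" by (auto simp: S_def)
  have Ms: "M \<le> s" by (simp add: M_def s_def count_le_length)
  have mult: "Defs.mult (x # la) i = (if i = x then Suc M else Defs.mult la i)" for i
    by (simp add: Defs.mult_def M_def)
  have multx: "Defs.mult la x = M" by (simp add: Defs.mult_def M_def)
  \<comment> \<open>\<open>x\<close> may be absent from \<open>la\<close>; multiplicity 0 adds 0
    here and gives a factor 1 in the product below.\<close>
  have ext: "(\<Sum>i\<in>set la. (Defs.mult la i)\<^sup>2) = (\<Sum>i\<in>S. (Defs.mult la i)\<^sup>2)"
    by (rule sum.mono_neutral_left) (auto simp: S_def Defs.mult_def)
  have sum1: "(\<Sum>i\<in>S. (Defs.mult la i)\<^sup>2) = M\<^sup>2 + (\<Sum>i\<in>S - {x}. (Defs.mult la i)\<^sup>2)"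
    using finS by (simp add: sum.remove multx)
  have sum2: "(\<Sum>i\<in>S. (Defs.mult (x # la) i)\<^sup>2) = (Suc M)\<^sup>2 + (\<Sum>i\<in>S - {x}. (Defs.mult la i)\<^sup>2)"
    using finS by (subst sum.remove[of S x]) (auto simp: mult intro!: sum.cong)
  have le: "(\<Sum>i\<in>S. (Defs.mult la i)\<^sup>2) \<le> s\<^sup>2"
    using sum_mult_squared_le[of la] by (simp add: ext s_def)
  have e1: "(Suc s)\<^sup>2 - (\<Sum>i\<in>S. (Defs.mult (x # la) i)\<^sup>2) = (s\<^sup>2 - (\<Sum>i\<in>S. (Defs.mult la i)\<^sup>2)) + 2 * (s - M)"
    using le Ms unfolding sum1 sum2 by (simp add: power2_eq_square algebra_simps)
  have e: "q ^ (b * ((Suc s)\<^sup>2 - (\<Sum>i\<in>S. (Defs.mult (x # la) i)\<^sup>2)) div 2)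
     = q ^ (b * (s - M)) * q ^ (b * (s\<^sup>2 - (\<Sum>i\<in>set la. (Defs.mult la i)\<^sup>2)) div 2)"
  proof -
    have "b * ((Suc s)\<^sup>2 - (\<Sum>i\<in>S. (Defs.mult (x # la) i)\<^sup>2)) div 2
        = (b * (s\<^sup>2 - (\<Sum>i\<in>S. (Defs.mult la i)\<^sup>2)) + 2 * (b * (s - M))) div 2"
      unfolding e1 by (simp add: algebra_simps)
    also have "\<dots> = b * (s - M) + b * (s\<^sup>2 - (\<Sum>i\<in>S. (Defs.mult la i)\<^sup>2)) div 2" by simp
    finally show ?thesis by (simp add: ext power_add)
  qed
  define g where "g n = qpoch Q' Q' n / (1 - Q') ^ n" for n
  have gM: "g (Suc M) = (\<Sum>p<Suc M. Q' ^ p) * g M"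
  proof -
    have "1 - Q' ^ Suc M = (1 - Q') * (\<Sum>p<Suc M. Q' ^ p)" by (rule one_diff_power_eq)
    moreover have "qpoch Q' Q' (Suc M) = qpoch Q' Q' M * (1 - Q' ^ Suc M)"
      by (simp add: qpoch_def mult.commute)
    ultimately show ?thesis using Q by (simp add: g_def Q'_def)
  qed
  have "(\<Prod>i\<in>set la. g (Defs.mult la i)) = (\<Prod>i\<in>S. g (Defs.mult la i))"
    by (rule prod.mono_neutral_left) (auto simp: S_def Defs.mult_def g_def qpoch_def)
  also have "\<dots> = g M * (\<Prod>i\<in>S - {x}. g (Defs.mult la i))"
    using finS by (simp add: prod.remove multx)
  finally have *: "(\<Prod>i\<in>set la. g (Defs.mult la i)) = \<dots>" .
  have p: "(\<Prod>i\<in>S. g (Defs.mult (x # la) i)) = (\<Sum>p<Suc M. Q' ^ p) * (\<Prod>i\<in>set la. g (Defs.mult la i))"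
  proof -
    have "(\<Prod>i\<in>S - {x}. g (Defs.mult (x # la) i)) = (\<Prod>i\<in>S - {x}. g (Defs.mult la i))"
      by (rule prod.cong) (auto simp: mult)
    with * show ?thesis using finS gM by (simp add: prod.remove[of S x] mult mult.assoc)
  qed
  define f where "f n = qpoch Q' q n / qpoch q q n" for n
  have r: "(\<Prod>i<Suc s. f ((x # la) ! i + (Suc s - 1 - i) * b)) = f (x + s * b) * (\<Prod>i<s. f (la ! i + (s - 1 - i) * b))"
    by (simp add: prod.lessThan_Suc_shift del: prod.lessThan_Suc)
  have "c_lambda b q (x # la) = q ^ (b * ((Suc s)\<^sup>2 - (\<Sum>i\<in>S. (Defs.mult (x # la) i)\<^sup>2)) div 2) *
      (\<Prod>i\<in>S. g (Defs.mult (x # la) i)) * (\<Prod>i<Suc s. f ((x # la) ! i + (Suc s - 1 - i) * b))"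
    by (simp only: c_lambda_def Let_def g_def f_def Q'_def S_def s_def list.set list.size add_Suc_right add_0_right)
  moreover have "c_lambda b q la = q ^ (b * (s\<^sup>2 - (\<Sum>i\<in>set la. (Defs.mult la i)\<^sup>2)) div 2) *
      (\<Prod>i\<in>set la. g (Defs.mult la i)) * (\<Prod>i<s. f (la ! i + (s - 1 - i) * b))"
    by (simp only: c_lambda_def Let_def g_def f_def Q'_def s_def)
  ultimately show ?thesis
    unfolding e p r M_def[symmetric] s_def[symmetric] Q'_def[symmetric] f_def[symmetric]
    by (simp only: ac_simps)
qed


lemma wcoeff_cong: "(\<And>j. j \<in> J \<Longrightarrow> m j = m' j) \<Longrightarrow> wcoeff B q I J m = wcoeff B q I J m'"
  by (simp add: wcoeff_def cong: prod.cong)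

text \<open>In the coefficient of \<open>\<Prod> z\<^sub>i\<^bsup>\<lambda>\<^sub>i\<^esup>\<close>, the term of the pole \<open>w\<^sub>j = q\<^bsup>b\<^esup> z\<^sub>i\<close> only survives if \<open>\<lambda>\<^sub>i\<close> is
  maximal, and then only through its part of degree zero in the other \<open>z\<close> and \<open>w\<close>.\<close>
lemma lookup_pole_term:
  fixes l :: "nat \<Rightarrow> nat"
  assumes I: "finite I" "i \<in> I" and n: "l i \<le> n" and W: "keys W \<subseteq> zspan (I - {i})"
  shows "lookup (single (lmon (Zv i) (int n)) c * (pole_coeff B q I i b * W)) (\<Sum>i\<in>I. lmon (Zv i) (int (l i))) =
    (if l i = n then c * (lookup (pole_coeff B q I i b) 0 * lookup W (\<Sum>i\<in>I - {i}. lmon (Zv i) (int (l i)))) else 0)"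
proof -
  let ?K = "\<Sum>i\<in>I. lmon (Zv i) (int (l i))"
  have K: "lookup ?K (Zv i) = int (l i)"
    using I by (simp add: lookup_sum lookup_lmon)
  \<comment> \<open>\<open>W\<close> is free of \<open>z_i\<close>, so the exponent of
    \<open>z_i\<close> in \<open>a\<close> is \<open>l i - n\<close>, which is not positive; the
    pointed cone leaves only \<open>a = 0\<close>.\<close>
  have a0: "a = 0 \<and> l i = n" if a: "a \<in> keys (pole_coeff B q I i b)" and b: "?K - lmon (Zv i) (int n) - a \<in> keys W" for a
  proof -
    have "lookup (?K - lmon (Zv i) (int n) - a) (Zv i) = 0"
      using b W by (fastforce simp: zspan_def)
    hence eq: "lookup a (Zv i) = int (l i) - int n"
      by (simp add: lookup_minus K lookup_lmon)
    have ac: "a \<in> zcone i I" using a keys_pole_coeff[OF I] by blast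
    hence "a = 0" using eq n by (intro zcone_eq_zeroI[OF I]) auto
    thus ?thesis using eq by simp
  qed
  have "lookup (pole_coeff B q I i b * W) (?K - lmon (Zv i) (int n)) =
    lookup (pole_coeff B q I i b) 0 * lookup W (?K - lmon (Zv i) (int n) - 0)"
    by (rule lookup_mult_unique) (use a0 in blast)
  moreover have "lookup (pole_coeff B q I i b * W) (?K - lmon (Zv i) (int n)) = 0" if "l i \<noteq> n"
  proof (rule ccontr)
    assume "lookup (pole_coeff B q I i b * W) (?K - lmon (Zv i) (int n)) \<noteq> 0"
    then obtain a w where "a \<in> keys (pole_coeff B q I i b)" "w \<in> keys W" "?K - lmon (Zv i) (int n) = a + w"
      by (auto simp: in_keys_iff[symmetric] elim!: keys_multE)
    thus False using a0[of a] that by auto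
  qed
  moreover have "?K - lmon (Zv i) (int (l i)) = (\<Sum>i\<in>I - {i}. lmon (Zv i) (int (l i)))"
    using I by (simp add: sum.remove)
  ultimately show ?thesis by (auto simp: lookup_single_mult)
qed

text \<open>The induction peels off the largest part \<open>x\<close>; that \<open>l\<close>
  decreases along \<open>I\<close> survives the deletion of any index. With \<open>s\<close> parts
  remaining, the node power gives \<open>q^(b x)\<close> and the pole coefficient
  \<open>q^(N b s)\<close>, so the residues carry \<open>q^(b (x + s N))\<close>: this is the origin
  of \<open>x + s N\<close> in \<open>c_lambda\<close>.\<close>

theorem wcoeff_partition:
  fixes l m :: "nat \<Rightarrow> nat"
  assumes q: "generic q" and N: "0 < N" and "finite I" "finite J" "sorted_wrt (\<ge>) la"
    "\<And>i j. i \<in> I \<Longrightarrow> j \<in> I \<Longrightarrow> i < j \<Longrightarrow> l j \<le> l i"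
    "mset la = image_mset l (mset_set I)" "mset la = image_mset m (mset_set J)"
  shows "lookup (wcoeff (\<lambda>_. N) q I J m) (\<Sum>i\<in>I. lmon (Zv i) (int (l i))) = c_lambda N q la"
  using assms(3-)
proof (induction la arbitrary: I J)
  case Nil
  hence "mset_set I = {#}" "mset_set J = {#}" by (metis image_mset_is_empty_iff mset.simps(1))+
  hence "I = {}" "J = {}" using Nil by (auto simp: mset_set_empty_iff)
  then show ?case by (simp add: wcoeff_def dyson_def c_lambda_def lookup_one)
next
  case (Cons x la)
  let ?W = "\<lambda>i J m. wcoeff (\<lambda>_. N) q (I - {i}) J m"
  have fin: "finite I" "finite J" by fact+
  have sets: "l ` I = insert x (set la)" "m ` J = insert x (set la)"
    using arg_cong[OF Cons.prems(5), of set_mset] arg_cong[OF Cons.prems(6), of set_mset] fin by auto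
  have max: "y \<le> x" if "y \<in> insert x (set la)" for y using Cons.prems(3) that by auto
  obtain j0 where j0: "j0 \<in> J" "m j0 = x" using sets(2) by (metis imageE insertI1)
  have ne: "nodes (\<lambda>_. N) I \<noteq> {}" using sets(1) N by (auto simp: nodes_def)
  let ?J = "J - {j0}" let ?K = "\<Sum>i\<in>I. lmon (Zv i) (int (l i))"
  define s where "s = length la"
  have cardI: "card I = Suc s"
    using arg_cong[OF Cons.prems(5), of size] by (simp add: s_def)
  have msJ: "mset la = image_mset m (mset_set ?J)"
    using Cons.prems(6) j0(2) mset_set.remove[OF fin(2) j0(1)] by simp
  have msI: "mset la = image_mset l (mset_set (I - {i}))" if "i \<in> I" "l i = x" for i
    using Cons.prems(5) that(2) mset_set.remove[OF fin(1) that(1)] by simp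
  have IH: "lookup (?W i ?J m) (\<Sum>i\<in>I - {i}. lmon (Zv i) (int (l i))) = c_lambda N q la"
    if "i \<in> I" "l i = x" for i
    by (rule Cons.IH) (use Cons.prems that msI msJ in auto)
  let ?z = "restrict (\<lambda>_. 0::nat) ?J"
  have pole_term: "(\<Sum>e\<in>PiE ?J (\<lambda>j. {..m j}). lookup (single (lmon (Zv i) (int (m j0 + sum e ?J)))
      (q ^ (b * m j0) * node_wt q N b * (\<Prod>j\<in>?J. hsym (\<lambda>b. q ^ b) {..<N} (e j))) *
      (pole_coeff (\<lambda>_. N) q I i b * ?W i ?J (\<lambda>j. m j - e j))) ?K)
    = (if l i = x then q ^ (N * card {j \<in> I. i < j}) * (q ^ (b * (x + s * N)) * node_wt q N b) * c_lambda N q la else 0)"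
    (is "(\<Sum>e\<in>_. ?t e) = _") if i: "i \<in> I" for i b
  proof -
    have lx: "l i \<le> x" using max sets(1) i by blast
    have t: "?t e = (if l i = x + sum e ?J then
        (q ^ (b * m j0) * node_wt q N b * (\<Prod>j\<in>?J. hsym (\<lambda>b. q ^ b) {..<N} (e j))) *
        (lookup (pole_coeff (\<lambda>_. N) q I i b) 0 * lookup (?W i ?J (\<lambda>j. m j - e j)) (\<Sum>i\<in>I - {i}. lmon (Zv i) (int (l i))))
        else 0)" for e
      using lx fin by (subst lookup_pole_term[OF fin(1) i]) (auto simp: j0 intro!: keys_wcoeff)
    \<comment> \<open>As \<open>l i \<le> x\<close>, the condition \<open>l i = x + sum e ?J\<close>
      leaves only \<open>e = 0\<close>.\<close>
    have "(\<Sum>e\<in>PiE ?J (\<lambda>j. {..m j}). ?t e) = (\<Sum>e\<in>{?z}. ?t e)"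
    proof (rule sum.mono_neutral_right)
      show "\<forall>e\<in>PiE ?J (\<lambda>j. {..m j}) - {?z}. ?t e = 0"
      proof
        fix e assume e: "e \<in> PiE ?J (\<lambda>j. {..m j}) - {?z}"
        have "sum e ?J \<noteq> 0"
        proof
          assume "sum e ?J = 0"
          hence "e = ?z" using e fin by (auto simp: fun_eq_iff restrict_def PiE_def extensional_def)
          thus False using e by simp
        qed
        thus "?t e = 0" using lx unfolding t by simp
      qed
    qed (use fin in \<open>auto intro!: finite_PiE\<close>)
    also have "\<dots> = ?t ?z" by simp
    also have "\<dots> = (if l i = x then
        q ^ (b * x) * node_wt q N b * (lookup (pole_coeff (\<lambda>_. N) q I i b) 0 * c_lambda N q la) else 0)"
    proof -
      have "?W i ?J (\<lambda>j. m j - ?z j) = ?W i ?J m" by (rule wcoeff_cong) simp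
      moreover have "sum ?z ?J = 0" by simp
      moreover have "(\<Prod>j\<in>?J. hsym (\<lambda>b. q ^ b) {..<N} (?z j)) = 1" by (simp add: hsym_0)
      ultimately show ?thesis unfolding t using IH[OF i] by (simp add: j0)
    qed
    also have "lookup (pole_coeff (\<lambda>_. N) q I i b) 0 = q ^ (N * (b * s + card {j \<in> I. i < j}))"
      using lookup_0_pole_coeff[OF fin(1) i, of q N b] q by (simp add: cardI generic_def)
    finally show ?thesis
      by (simp add: power_add algebra_simps)
  qed
  have "lookup (wcoeff (\<lambda>_. N) q I J m) ?K = (\<Sum>(i, b)\<in>nodes (\<lambda>_. N) I.
     if l i = x then q ^ (N * card {j \<in> I. i < j}) * (q ^ (b * (x + s * N)) * node_wt q N b) * c_lambda N q la else 0)"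
    unfolding wcoeff_expand[OF q fin(1) ne fin(2) j0(1)] lookup_sum case_prod_unfold
    by (rule sum.cong[OF refl], rule pole_term) (auto simp: nodes_def)
  also have "\<dots> = (\<Sum>i\<in>I. \<Sum>b<N.
     if l i = x then q ^ (N * card {j \<in> I. i < j}) * (q ^ (b * (x + s * N)) * node_wt q N b) * c_lambda N q la else 0)"
    unfolding nodes_def using fin by (subst sum.Sigma) auto
  also have "\<dots> = (\<Sum>i\<in>I. if l i = x then q ^ (N * card {j \<in> I. i < j}) *
      (\<Sum>b<N. q ^ (b * (x + s * N)) * node_wt q N b) * c_lambda N q la else 0)"
    by (rule sum.cong) (auto simp: sum_distrib_left sum_distrib_right)
  also have "\<dots> = (\<Sum>i\<in>{i \<in> I. l i = x}. q ^ (N * card {j \<in> I. i < j})) *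
      (\<Sum>b<N. q ^ (b * (x + s * N)) * node_wt q N b) * c_lambda N q la"
    using fin by (simp add: sum.inter_filter sum_distrib_right) (auto intro!: sum.cong)
  also have "(\<Sum>i\<in>{i \<in> I. l i = x}. q ^ (N * card {j \<in> I. i < j}))
      = q ^ (N * (s - count_list la x)) * (\<Sum>p<Suc (count_list la x). (q ^ N) ^ p)"
  proof -
    let ?I0 = "{i \<in> I. l i = x}"
    have "card ?I0 = count (mset (x # la)) x"
      unfolding Cons.prems(5) using fin by (auto simp: count_image_mset' intro!: arg_cong[where f = card])
    hence c0: "card ?I0 = Suc (count_list la x)" by (simp add: count_mset)
    have sub: "?I0 \<subseteq> I" by auto
    have c1: "card (I - ?I0) = s - count_list la x"
      using fin c0 cardI by (simp add: card_Diff_subset)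
    have "card {j \<in> I. i < j} = (s - count_list la x) + card {j \<in> ?I0. i < j}" if i: "i \<in> ?I0" for i
    proof -
      \<comment> \<open>\<open>l\<close> decreases along \<open>I\<close>, so the indices of the
        maximal value precede all others, which add the constant offset
        \<open>s - count_list la x\<close> to every rank.\<close>
      have "i < j" if "j \<in> I - ?I0" for j
      proof (rule ccontr)
        assume "\<not> i < j"
        hence "j < i" using i that by (cases "i = j") auto
        hence "x \<le> l j" using Cons.prems(4)[of j i] i that by auto
        moreover have "l j \<le> x" using max sets(1) that by blast
        ultimately show False using that by auto
      qed
      hence "{j \<in> I. i < j} = (I - ?I0) \<union> {j \<in> ?I0. i < j}" by auto
      hence "card {j \<in> I. i < j} = card ((I - ?I0) \<union> {j \<in> ?I0. i < j})" by (rule arg_cong)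
      also have "\<dots> = card (I - ?I0) + card {j \<in> ?I0. i < j}"
        using fin by (intro card_Un_disjoint) auto
      finally show ?thesis unfolding c1 .
    qed
    hence "(\<Sum>i\<in>?I0. q ^ (N * card {j \<in> I. i < j})) =
        (\<Sum>i\<in>?I0. q ^ (N * (s - count_list la x)) * (q ^ N) ^ card {j \<in> ?I0. i < j})"
      by (intro sum.cong) (simp_all add: distrib_left power_add power_mult del: mem_Collect_eq)
    also have "\<dots> = q ^ (N * (s - count_list la x)) * (\<Sum>p<Suc (count_list la x). (q ^ N) ^ p)"
      using fin sum_power_card_greater[of ?I0 "q ^ N"] unfolding c0 by (simp flip: sum_distrib_left)
    finally show ?thesis .
  qed
  also have "(\<Sum>b<N. q ^ (b * (x + s * N)) * node_wt q N b) =
      qpoch (q ^ N) q (x + s * N) / qpoch q q (x + s * N)"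
    by (rule sum_node_wt[OF q N])
  also have "q ^ (N * (s - count_list la x)) * (\<Sum>p<Suc (count_list la x). (q ^ N) ^ p) *
      (qpoch (q ^ N) q (x + s * N) / qpoch q q (x + s * N)) * c_lambda N q la = c_lambda N q (x # la)"
    using q N by (simp add: c_lambda_Cons s_def generic_def)
  finally show ?case .
qed

section \<open>Truncated expansions and polynomiality in q\<close>

text \<open>The indeterminate stands for \<open>1/w_j\<close>, so that exponents of
  \<open>w_j\<close> become coefficient indices.\<close>

definition trunc_geom :: "('i \<Rightarrow> 'b::comm_ring_1) \<Rightarrow> 'i set \<Rightarrow> nat \<Rightarrow> 'b poly" where
  "trunc_geom a A N = (\<Prod>l\<in>A. \<Sum>n\<le>N. monom (a l ^ n) n)"

lemma poly_trunc_geom: "poly (trunc_geom a A N) v = (\<Prod>l\<in>A. \<Sum>n\<le>N. (a l * v) ^ n)"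
  by (simp add: trunc_geom_def poly_prod poly_sum poly_monom power_mult_distrib)

lemma coeff_trunc_geom:
  assumes "finite A" "n \<le> N"
  shows "coeff (trunc_geom a A N) n = hsym a A n"
  using assms
proof (induction A arbitrary: n rule: finite_induct)
  case empty
  then show ?case by (simp add: trunc_geom_def hsym_empty)
next
  case (insert l A)
  have "trunc_geom a (insert l A) N = (\<Sum>n\<le>N. monom (a l ^ n) n) * trunc_geom a A N"
    using insert.hyps by (simp add: trunc_geom_def)
  moreover have "coeff (\<Sum>n\<le>N. monom (a l ^ n) n) i = a l ^ i" if "i \<le> n" for i
    using that insert.prems by (simp add: coeff_sum)
  ultimately show ?case
    using insert by (simp add: coeff_mult hsym_insert)
qed

lemma keys_coeff_trunc_geom:
  fixes a :: "'i \<Rightarrow> 'k::comm_monoid_add \<Rightarrow>\<^sub>0 'b::comm_ring_1"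
  assumes "finite A" "\<And>l. l \<in> A \<Longrightarrow> keys (a l) \<subseteq> S" "0 \<in> S" "\<And>x y. x \<in> S \<Longrightarrow> y \<in> S \<Longrightarrow> x + y \<in> S"
  shows "keys (coeff (trunc_geom a A N) n) \<subseteq> S"
  using assms(1,2)
proof (induction A arbitrary: n rule: finite_induct)
  case empty
  then show ?case using assms(3) by (simp add: trunc_geom_def)
next
  case (insert l A)
  have "trunc_geom a (insert l A) N = (\<Sum>n\<le>N. monom (a l ^ n) n) * trunc_geom a A N"
    using insert.hyps by (simp add: trunc_geom_def)
  moreover have "keys (a l ^ i) \<subseteq> S" for i
    using keys_prod_subset[of "{..<i}" "\<lambda>_. a l" S] insert.prems assms(3,4) by simp
  hence "keys (coeff (\<Sum>n\<le>N. monom (a l ^ n) n) i) \<subseteq> S" for i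
    by (simp add: coeff_sum)
  ultimately show ?case
    using insert by (simp add: coeff_mult keys_sum_subset keys_mult_subset assms(4))
qed

lemma F_trunc_eq:
  "F_trunc \<beta> t q N = dyson (nth \<beta>) q {..<length \<beta>} *
    (\<Prod>j<t. poly (trunc_geom (node q) (nodes (nth \<beta>) {..<length \<beta>}) N) (single (lmon (Wv j) (-1)) 1))"
proof -
  have 1: "{i<..<length \<beta>} = {j \<in> {..<length \<beta>}. i < j}" for i by auto
  have 2: "lconst (q ^ b) * ratio (Zv i) (Wv j) = node q (i, b) * single (lmon (Wv j) (-1)) 1" for i j b
    by (simp add: lconst_def ratio_eq node_def mult_single)
  have "(\<Prod>i<length \<beta>. \<Prod>j<t. \<Prod>b<\<beta> ! i. \<Sum>n\<le>N. (lconst (q ^ b) * ratio (Zv i) (Wv j)) ^ n)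
    = (\<Prod>j<t. \<Prod>i<length \<beta>. \<Prod>b<\<beta> ! i. \<Sum>n\<le>N. (node q (i, b) * single (lmon (Wv j) (-1)) 1) ^ n)"
    unfolding 2 by (rule prod.swap)
  also have "\<dots> = (\<Prod>j<t. poly (trunc_geom (node q) (nodes (nth \<beta>) {..<length \<beta>}) N) (single (lmon (Wv j) (-1)) 1))"
    unfolding poly_trunc_geom nodes_def by (subst prod.Sigma) (simp_all add: case_prod_unfold)
  finally show ?thesis unfolding F_trunc_def dyson_def dyson_pair_def 1 by simp
qed

lemma poly_eq_sum_atMost:
  fixes p :: "'b::comm_ring_1 poly"
  shows "degree p \<le> d \<Longrightarrow> poly p x = (\<Sum>i\<le>d. coeff p i * x ^ i)"
  unfolding poly_altdef by (rule sum.mono_neutral_left) (auto simp: coeff_eq_0)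

text \<open>Expansion in powers of the \<open>1/w_j\<close> has coefficients \<open>f \<mu>\<close>
  free of \<open>w\<close>, so only the exponent \<open>m\<close> can match, and up to degree
  \<open>N\<close> the truncation changes nothing.\<close>

lemma lookup_F_trunc:
  fixes q :: "'a::comm_ring_1"
  assumes m: "length m = t" "\<And>j. j < t \<Longrightarrow> m ! j \<le> N" and k: "length k = length \<beta>"
  shows "lookup (F_trunc \<beta> t q N) (expo k m) =
    lookup (wcoeff (nth \<beta>) q {..<length \<beta>} {..<t} (nth m)) (\<Sum>i<length \<beta>. lmon (Zv i) (k ! i))"
proof -
  define I where "I = {..<length \<beta>}"
  \<comment> \<open>\<open>d\<close> bounds \<open>degree P\<close>; the summand \<open>N\<close>
    keeps every \<open>m ! j\<close> in range even if \<open>P\<close> has small degree.\<close>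
  define D P d where "D = dyson (nth \<beta>) q I"
    and "P = trunc_geom (node q) (nodes (nth \<beta>) I) N" and "d = degree P + N"
  define K where "K = (\<Sum>i<length \<beta>. lmon (Zv i) (k ! i))"
  define f where "f \<mu> = D * (\<Prod>j<t. coeff P (\<mu> j))" for \<mu> :: "nat \<Rightarrow> nat"
  have pow: "(single (lmon (Wv j) (-1)) 1) ^ n = (single (lmon (Wv j) (- int n)) 1 :: 'a lpoly)" for j n
    by (induction n) (simp_all add: lmon_0 mult_single lmon_add)
  have fI: "finite I" by (simp add: I_def)
  have keys_f: "keys (f \<mu>) \<subseteq> zspan I" for \<mu>
    unfolding f_def D_def P_def using keys_dyson[OF fI, of "nth \<beta>" q]
    by (intro keys_mult_subset keys_prod_subset keys_coeff_trunc_geom finite_nodes keys_node fI zspan_zero zspan_add) auto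
  have "F_trunc \<beta> t q N = D * (\<Prod>j<t. \<Sum>i\<in>{..d}. coeff P i * single (lmon (Wv j) (-1)) 1 ^ i)"
  proof -
    have "poly P x = (\<Sum>i\<le>d. coeff P i * x ^ i)" for x
      by (rule poly_eq_sum_atMost) (simp add: d_def)
    thus ?thesis by (simp add: F_trunc_eq D_def I_def flip: P_def[unfolded I_def])
  qed
  also have "(\<Prod>j<t. \<Sum>i\<in>{..d}. coeff P i * single (lmon (Wv j) (-1)) 1 ^ i) =
      (\<Sum>\<mu>\<in>PiE {..<t} (\<lambda>_. {..d}). \<Prod>j<t. coeff P (\<mu> j) * single (lmon (Wv j) (-1)) 1 ^ \<mu> j)"
    by (rule prod_sum_PiE) auto
  also have "D * \<dots> = (\<Sum>\<mu>\<in>PiE {..<t} (\<lambda>_. {..d}). single (\<Sum>j<t. lmon (Wv j) (- int (\<mu> j))) 1 * f \<mu>)"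
    by (simp add: sum_distrib_left f_def pow prod.distrib prod_single ac_simps)
  finally have F: "F_trunc \<beta> t q N = \<dots>" .
  have E: "expo k m = K + (\<Sum>j<t. lmon (Wv j) (- int (m ! j)))"
    by (simp add: expo_def K_def lmon_def m k)
  have t0: "lookup (single (\<Sum>j<t. lmon (Wv j) (- int (\<mu> j))) 1 * f \<mu>) (expo k m)
      = (if \<forall>j<t. \<mu> j = m ! j then lookup (f \<mu>) K else 0)" for \<mu>
  proof -
    have L: "lookup (single (\<Sum>j<t. lmon (Wv j) (- int (\<mu> j))) 1 * f \<mu>) (expo k m)
      = lookup (f \<mu>) (expo k m - (\<Sum>j<t. lmon (Wv j) (- int (\<mu> j))))"
      by (simp add: lookup_single_mult)
    show ?thesis
    proof (cases "\<forall>j<t. \<mu> j = m ! j")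
      case True
      thus ?thesis unfolding L by (simp add: E)
    next
      case False
      then obtain j where j: "j < t" "\<mu> j \<noteq> m ! j" by blast
      have "lookup (expo k m - (\<Sum>j<t. lmon (Wv j) (- int (\<mu> j)))) (Wv j) = int (\<mu> j) - int (m ! j)"
        using j unfolding E K_def by (simp add: lookup_minus lookup_add lookup_sum lookup_lmon)
      hence "expo k m - (\<Sum>j<t. lmon (Wv j) (- int (\<mu> j))) \<notin> zspan I"
        using j by (auto simp: zspan_def intro!: exI[of _ "Wv j"])
      hence "expo k m - (\<Sum>j<t. lmon (Wv j) (- int (\<mu> j))) \<notin> keys (f \<mu>)" using keys_f by blast
      thus ?thesis unfolding L if_not_P[OF False] by (simp add: in_keys_iff)
    qed
  qed
  let ?m = "restrict (nth m) {..<t}"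
  have "lookup (F_trunc \<beta> t q N) (expo k m)
      = (\<Sum>\<mu>\<in>PiE {..<t} (\<lambda>_. {..d}). if \<forall>j<t. \<mu> j = m ! j then lookup (f \<mu>) K else 0)"
    unfolding F lookup_sum t0 ..
  also have "\<dots> = (\<Sum>\<mu>\<in>{?m}. if \<forall>j<t. \<mu> j = m ! j then lookup (f \<mu>) K else 0)"
  proof (rule sum.mono_neutral_right)
    show "{?m} \<subseteq> PiE {..<t} (\<lambda>_. {..d})"
      using m by (auto simp: d_def trans_le_add2)
    show "\<forall>\<mu>\<in>PiE {..<t} (\<lambda>_. {..d}) - {?m}. (if \<forall>j<t. \<mu> j = m ! j then lookup (f \<mu>) K else 0) = 0"
      by (auto simp: fun_eq_iff PiE_def extensional_def)
  qed (auto intro!: finite_PiE)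
  also have "\<dots> = lookup (f (nth m)) K"
  proof -
    have "f ?m = f (nth m)" unfolding f_def by (intro arg_cong2[where f = "(*)"] prod.cong refl) simp
    thus ?thesis by simp
  qed
  also have "f (nth m) = wcoeff (nth \<beta>) q I {..<t} (nth m)"
    unfolding f_def D_def P_def wcoeff_def
    by (intro arg_cong2[where f = "(*)"] prod.cong refl coeff_trunc_geom finite_nodes fI) (simp add: m)
  finally show ?thesis unfolding K_def I_def .
qed

text \<open>From \<open>N = sum_list m\<close> on, the truncation order is at least every
  \<open>m ! j\<close>, so the coefficient is constant and the description has a unique
  value.\<close>

lemma F_coeff_eq:
  assumes "length m = t" "length k = length \<beta>"
  shows "F_coeff \<beta> t q k m =
    lookup (wcoeff (nth \<beta>) q {..<length \<beta>} {..<t} (nth m)) (\<Sum>i<length \<beta>. lmon (Zv i) (k ! i))"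
    (is "_ = ?c")
proof -
  have "lookup (F_trunc \<beta> t q N) (expo k m) = ?c" if "sum_list m \<le> N" for N
    by (rule lookup_F_trunc)
      (use assms that order.trans[OF member_le_sum_list[OF nth_mem]] in auto)
  hence ev: "\<forall>\<^sub>F N in sequentially. lookup (F_trunc \<beta> t q N) (expo k m) = ?c"
    by (auto simp: eventually_sequentially)
  show ?thesis unfolding F_coeff_def
  proof (rule the_equality)
    show "\<forall>\<^sub>F N in sequentially. lookup (F_trunc \<beta> t q N) (expo k m) = ?c" by (rule ev)
    fix c assume "\<forall>\<^sub>F N in sequentially. lookup (F_trunc \<beta> t q N) (expo k m) = c"
    with ev have "\<forall>\<^sub>F N in sequentially. c = ?c" by eventually_elim simp
    thus "c = ?c" by simp
  qed
qed

section \<open>Polynomial dependence on \<open>q\<close>\<close>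

text \<open>Finite sums of monomials with fixed exponents and coefficients polynomial in
  \<open>q\<close>; the inductive form gives closure under products without tracking
  supports.\<close>

inductive poly_family :: "('a::comm_ring_1 \<Rightarrow> 'a lpoly) \<Rightarrow> bool" where
  single: "poly_family (\<lambda>q. single e (poly p q))"
| add: "poly_family f \<Longrightarrow> poly_family g \<Longrightarrow> poly_family (\<lambda>q. f q + g q)"

lemma poly_family_const: "poly_family (\<lambda>_. single e c)"
  using poly_family.single[of e "[:c:]"] by simp

lemma poly_family_mult:
  assumes "poly_family f" "poly_family g"
  shows "poly_family (\<lambda>q. f q * g q)"
  using assms(1)
proof (induction rule: poly_family.induct)
  case (single e p)
  show ?case using assms(2)
  proof (induction rule: poly_family.induct)
    case (single e' p')
    then show ?case using poly_family.single[of "e + e'" "p * p'"] by (simp add: mult_single)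
  next
    case (add f g)
    then show ?case using poly_family.add by (fastforce simp: distrib_left)
  qed
next
  case (add f g)
  then show ?case using poly_family.add by (fastforce simp: distrib_right)
qed

lemma poly_family_lconst: "poly_family (\<lambda>q. lconst (q ^ b))"
  using poly_family.single[of 0 "monom 1 b"] by (simp add: lconst_def poly_monom)

lemma poly_family_one: "poly_family (\<lambda>_. 1)"
  using poly_family_const[of 0 1] by simp

lemma poly_family_prod: "(\<And>i. i \<in> A \<Longrightarrow> poly_family (f i)) \<Longrightarrow> poly_family (\<lambda>q. \<Prod>i\<in>A. f i q)"
  by (induction A rule: infinite_finite_induct) (simp_all add: poly_family_one poly_family_mult)

lemma poly_family_power: "poly_family f \<Longrightarrow> poly_family (\<lambda>q. f q ^ n)"
  using poly_family_prod[of "{..<n}" "\<lambda>_. f"] by simp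

lemma poly_family_sum: "(\<And>i. i \<in> A \<Longrightarrow> poly_family (f i)) \<Longrightarrow> poly_family (\<lambda>q. \<Sum>i\<in>A. f i q)"
proof (induction A rule: infinite_finite_induct)
  case (insert i A)
  then show ?case using poly_family.add[of "f i" "\<lambda>q. \<Sum>i\<in>A. f i q"] by simp
qed (use poly_family_const[of 0 0] in simp_all)

lemma poly_family_one_minus: "poly_family f \<Longrightarrow> poly_family (\<lambda>q. 1 - f q)"
  using poly_family.add[OF poly_family_one poly_family_mult[OF poly_family_const[of 0 "-1"]]]
  by (simp add: single_uminus)

lemma poly_family_qpoch: "poly_family f \<Longrightarrow> poly_family (\<lambda>q. qpoch (f q) (lconst q) n)"
  unfolding qpoch_def lconst_power[symmetric]
  by (intro poly_family_prod poly_family_one_minus poly_family_mult poly_family_lconst)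

lemma poly_family_F_trunc: "poly_family (\<lambda>q. F_trunc \<beta> t q N)"
  unfolding F_trunc_def ratio_def using poly_family_lconst[of 1]
  by (intro poly_family_mult poly_family_prod poly_family_qpoch poly_family_sum poly_family_power
      poly_family_lconst poly_family_const) simp

lemma poly_family_lookup:
  assumes "poly_family f"
  shows "\<exists>p. \<forall>q. lookup (f q) e = poly p q"
  using assms
proof (induction rule: poly_family.induct)
  case (single e' p)
  show ?case by (intro exI[of _ "if e' = e then p else 0"]) (simp add: lookup_single)
next
  case (add f g)
  then obtain p p' where "\<forall>q. lookup (f q) e = poly p q" "\<forall>q. lookup (g q) e = poly p' q" by blast
  then show ?case by (intro exI[of _ "p + p'"]) (simp add: lookup_add)
qed

text \<open>The truncation order \<open>sum_list m\<close> serves all \<open>q\<close> at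
  once.\<close>

lemma F_coeff_poly:
  assumes "length m = t" "length k = length \<beta>"
  shows "\<exists>p. \<forall>q. F_coeff \<beta> t q k m = poly p q"
proof -
  have "F_coeff \<beta> t q k m = lookup (F_trunc \<beta> t q (sum_list m)) (expo k m)" for q
    unfolding F_coeff_eq[OF assms]
    by (rule lookup_F_trunc[symmetric]) (use assms member_le_sum_list[OF nth_mem] in auto)
  thus ?thesis using poly_family_lookup[OF poly_family_F_trunc] by metis
qed

text \<open>In characteristic 0 the integers \<open>2, 3, ...\<close> are generic, and there are
  infinitely many of them.\<close>

lemma poly_eq_0_generic:
  fixes p :: "'a::field_char_0 poly"
  assumes "\<And>q. generic q \<Longrightarrow> poly p q = 0"
  shows "p = 0"
proof (rule ccontr)
  assume "p \<noteq> 0"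
  have "generic (of_nat (n + 2) :: 'a)" for n
  proof -
    have "(n + 2) ^ i \<noteq> 1" if "i \<ge> 1" for i
      using that one_less_power[of "n + 2" i] by simp
    hence "(of_nat (n + 2) :: 'a) ^ i \<noteq> 1" if "i \<ge> 1" for i
      using that by (metis of_nat_power of_nat_eq_1_iff)
    thus ?thesis unfolding generic_def by (metis of_nat_eq_0_iff add_is_0 zero_neq_numeral)
  qed
  hence "range (\<lambda>n. of_nat (n + 2) :: 'a) \<subseteq> {q. poly p q = 0}" using assms by blast
  moreover have "infinite (range (\<lambda>n. of_nat (n + 2) :: 'a))"
    by (intro range_inj_infinite) (auto simp: inj_on_def)
  ultimately show False using poly_roots_finite[OF \<open>p \<noteq> 0\<close>] finite_subset by blast
qed

section \<open>Partial sums of sorted vectors\<close>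

text \<open>The head \<open>x\<close> is matched with an occurrence in \<open>M\<close> if there is
  one, otherwise with any element of \<open>M\<close>; that element is at most \<open>x\<close>, and
  the rest of \<open>M\<close> fits into the tail.\<close>

lemma sum_mset_le_sum_take:
  fixes xs :: "int list"
  assumes "sorted_wrt (\<ge>) xs" "M \<subseteq># mset xs" "size M = n"
  shows "sum_mset M \<le> sum_list (take n xs)"
  using assms
proof (induction xs arbitrary: M n)
  case (Cons x xs)
  show ?case
  proof (cases n)
    case (Suc n')
    obtain y where y: "y \<in># M" "x \<in># M \<longrightarrow> y = x"
      using Cons.prems(3) Suc by (metis Zero_not_Suc multiset_nonemptyE size_empty)
    have "y \<in> set (x # xs)" using y(1) Cons.prems(2) by (metis mset_subset_eqD set_mset_mset)
    hence yx: "y \<le> x" using Cons.prems(1) by auto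
    have sub: "M - {#y#} \<subseteq># mset xs"
    proof (rule mset_subset_eqI)
      fix z
      have *: "count M z \<le> count (mset (x # xs)) z" using Cons.prems(2) by (rule mset_subset_eq_count)
      have "count M x = 0" if "y \<noteq> x" using y(2) that by (auto simp: count_eq_zero_iff)
      thus "count (M - {#y#}) z \<le> count (mset xs) z" using * by (cases "z = x") auto
    qed
    have sorted: "sorted_wrt (\<ge>) xs" using Cons.prems(1) by simp
    have "size (M - {#y#}) = n'"
      using y(1) Cons.prems(3) Suc by (simp add: size_Diff_singleton)
    with sorted sub have "sum_mset (M - {#y#}) \<le> sum_list (take n' xs)" by (rule Cons.IH)
    moreover have "sum_mset M = y + sum_mset (M - {#y#})"
      using arg_cong[OF insert_DiffM[OF y(1)], of sum_mset] by simp
    ultimately show ?thesis using yx Suc by simp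
  qed (use Cons.prems in simp)
qed simp

lemma mset_eq_image_nth: "mset xs = image_mset (nth xs) (mset_set {..<length xs})"
  by (metis map_nth mset_map mset_upt lessThan_atLeast0)

lemma dec_sort_simps: "mset (dec_sort xs) = mset xs" "sorted_wrt (\<ge>) (dec_sort xs)" "length (dec_sort xs) = length xs"
  by (simp_all add: dec_sort_def sorted_wrt_rev)

lemma sum_le_sum_take_dec_sort:
  fixes k :: "int list"
  assumes "T \<subseteq> {..<length k}"
  shows "(\<Sum>i\<in>T. k ! i) \<le> sum_list (take (card T) (dec_sort k))"
proof -
  have "finite T" using assms finite_subset by blast
  hence "image_mset (nth k) (mset_set T) \<subseteq># mset (dec_sort k)"
    unfolding dec_sort_simps mset_eq_image_nth[of k] using assms
    by (intro image_mset_subseteq_mono) (simp add: subset_imp_msubset_mset_set)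
  hence "sum_mset (image_mset (nth k) (mset_set T)) \<le> sum_list (take (card T) (dec_sort k))"
    by (intro sum_mset_le_sum_take dec_sort_simps) auto
  thus ?thesis by (simp add: sum_unfold_sum_mset)
qed

lemma sum_take_dec_sort_attained:
  fixes m :: "int list"
  shows "\<exists>S\<subseteq>{..<length m}. card S = min r (length m) \<and> sum_list (take r (dec_sort m)) = (\<Sum>j\<in>S. m ! j)"
proof -
  have "image_mset (nth m) (mset_set {..<length m}) = mset (take r (dec_sort m)) + mset (drop r (dec_sort m))"
    by (simp add: dec_sort_simps flip: mset_eq_image_nth mset_append)
  then obtain A C where A: "mset_set {..<length m} = A + C" "mset (take r (dec_sort m)) = image_mset (nth m) A"
    by (metis image_mset_eq_plusD)
  \<comment> \<open>\<open>A\<close> consists of positions, which do not repeat, even though the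
    values of \<open>m\<close> may.\<close>
  have "A = mset_set (set_mset A)"
  proof (rule multiset_eqI)
    fix x
    have "count A x \<le> count (mset_set {..<length m}) x" by (simp add: A(1))
    also have "\<dots> \<le> 1" by (simp add: count_mset_set')
    finally show "count A x = count (mset_set (set_mset A)) x"
      by (cases "x \<in># A") (auto simp: count_mset_set' count_eq_zero_iff le_Suc_eq)
  qed
  then obtain S where S: "A = mset_set S" "finite S" by blast
  have "set_mset A \<subseteq> set_mset (mset_set {..<length m})" by (simp add: A(1))
  hence "S \<subseteq> {..<length m}" using S by simp
  moreover have "card S = min r (length m)"
    using arg_cong[OF A(2), of size] S by (simp add: dec_sort_simps min.commute)
  moreover have "sum_list (take r (dec_sort m)) = (\<Sum>j\<in>S. m ! j)"
    using arg_cong[OF A(2), of sum_mset] S by (simp add: sum_mset_sum_list sum_unfold_sum_mset)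
  ultimately show ?thesis by blast
qed

lemma F_coeff_dominates_generic:
  assumes q: "generic q" and \<beta>: "\<forall>b\<in>set \<beta>. 0 < b"
    and len: "length k = length \<beta>" "length m = t" and nz: "F_coeff \<beta> t q k m \<noteq> 0"
  shows "dominates (dec_sort k) (dec_sort (map int m))"
  unfolding dominates_def
proof
  fix r
  let ?I = "{..<length \<beta>}" and ?K = "\<Sum>i<length \<beta>. lmon (Zv i) (k ! i)"
  have K: "?K \<in> keys (wcoeff (nth \<beta>) q ?I {..<t} (nth m))"
    using nz[unfolded F_coeff_eq[OF len(2,1)]] by (simp add: in_keys_iff)
  obtain S where S: "S \<subseteq> {..<t}" "card S = min r t"
    "sum_list (take r (dec_sort (map int m))) = (\<Sum>j\<in>S. map int m ! j)"
    using sum_take_dec_sort_attained[of "map int m" r] len by auto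
  obtain T where T: "T \<subseteq> ?I" "card T = min r (card ?I)"
    "(\<Sum>j\<in>S. int (m ! j)) \<le> (\<Sum>i\<in>T. lookup ?K (Zv i))"
    using wcoeff_dominates[OF q _ _ K, of S r] \<beta> S by auto
  have "sum_list (take r (dec_sort (map int m))) = (\<Sum>j\<in>S. int (m ! j))"
    unfolding S(3) by (rule sum.cong) (use S(1) len in auto)
  also have "\<dots> \<le> (\<Sum>i\<in>T. lookup ?K (Zv i))" by (rule T(3))
  also have "\<dots> = (\<Sum>i\<in>T. k ! i)"
    by (rule sum.cong) (use T(1) in \<open>auto simp: lookup_sum lookup_lmon\<close>)
  also have "\<dots> \<le> sum_list (take (card T) (dec_sort k))"
    using T(1) len by (intro sum_le_sum_take_dec_sort) simp
  also have "take (card T) (dec_sort k) = take r (dec_sort k)"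
    using T(2) len by (simp add: min_def dec_sort_simps)
  finally show "sum_list (take r (dec_sort (map int m))) \<le> sum_list (take r (dec_sort k))" .
qed

lemma wcoeff_cong_beta:
  assumes "\<And>i. i \<in> I \<Longrightarrow> B i = B' i"
  shows "wcoeff B q I J m = wcoeff B' q I J m"
proof -
  have "nodes B I = nodes B' I"
    unfolding nodes_def by (rule Sigma_cong) (simp_all add: assms)
  moreover have "dyson B q I = dyson B' q I"
    unfolding dyson_def dyson_pair_def by (intro prod.cong refl) (simp add: assms)
  ultimately show ?thesis by (simp only: wcoeff_def)
qed

lemma F_coeff_partition_generic:
  assumes q: "generic q" and b: "0 < b" and la: "is_partition la"
  shows "F_coeff (replicate (length la) b) (length la) q (map int la) la = c_lambda b q la"
proof -
  let ?I = "{..<length la}"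
  have sorted: "sorted_wrt (\<ge>) la"
    using la by (simp add: is_partition_def sorted_wrt_rev)
  have "F_coeff (replicate (length la) b) (length la) q (map int la) la =
      lookup (wcoeff (nth (replicate (length la) b)) q ?I ?I (nth la)) (\<Sum>i\<in>?I. lmon (Zv i) (map int la ! i))"
    by (subst F_coeff_eq) simp_all
  also have "wcoeff (nth (replicate (length la) b)) q ?I ?I (nth la) = wcoeff (\<lambda>_. b) q ?I ?I (nth la)"
    by (rule wcoeff_cong_beta) simp
  also have "(\<Sum>i\<in>?I. lmon (Zv i) (map int la ! i)) = (\<Sum>i\<in>?I. lmon (Zv i) (int (la ! i)))"
    by (rule sum.cong) simp_all
  also have "lookup (wcoeff (\<lambda>_. b) q ?I ?I (nth la)) \<dots> = c_lambda b q la"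
    by (rule wcoeff_partition[OF q b _ _ sorted _ mset_eq_image_nth mset_eq_image_nth])
      (use sorted_wrt_nth_less[OF sorted] in simp_all)
  finally show ?thesis .
qed

section \<open>Extension to special values of \<open>q\<close>\<close>

definition poly_fun :: "('a::comm_ring_1 \<Rightarrow> 'a) \<Rightarrow> bool" where
  "poly_fun f \<longleftrightarrow> (\<exists>p. \<forall>q. f q = poly p q)"

lemma poly_fun_mult: "poly_fun f \<Longrightarrow> poly_fun g \<Longrightarrow> poly_fun (\<lambda>q. f q * g q)"
  unfolding poly_fun_def by (metis poly_mult)

lemma poly_fun_diff: "poly_fun f \<Longrightarrow> poly_fun g \<Longrightarrow> poly_fun (\<lambda>q. f q - g q)"
  unfolding poly_fun_def by (metis poly_diff)

lemma poly_fun_const: "poly_fun (\<lambda>_. c)"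
  unfolding poly_fun_def by (rule exI[of _ "[:c:]"]) simp

lemma poly_fun_id: "poly_fun (\<lambda>q. q)"
  unfolding poly_fun_def by (rule exI[of _ "[:0, 1:]"]) simp

lemma poly_fun_prod: "(\<And>i. i \<in> A \<Longrightarrow> poly_fun (f i)) \<Longrightarrow> poly_fun (\<lambda>q. \<Prod>i\<in>A. f i q)"
  by (induction A rule: infinite_finite_induct) (simp_all add: poly_fun_const poly_fun_mult)

lemma poly_fun_power: "poly_fun f \<Longrightarrow> poly_fun (\<lambda>q. f q ^ n)"
  using poly_fun_prod[of "{..<n}" "\<lambda>_. f"] by simp

lemma poly_fun_qpoch: "poly_fun f \<Longrightarrow> poly_fun g \<Longrightarrow> poly_fun (\<lambda>q. qpoch (f q) (g q) n)"
  unfolding qpoch_def by (intro poly_fun_prod poly_fun_diff poly_fun_const poly_fun_mult poly_fun_power)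

text \<open>Clearing denominators turns the formula into a polynomial identity, which extends from
  generic \<open>q\<close> to \<open>q = 0\<close>, the only other value with all positive powers
  different from 1.\<close>

lemma c_lambda_quotient:
  assumes b: "0 < b"
  obtains num den :: "'a::field \<Rightarrow> 'a" where "poly_fun num" "poly_fun den"
    "\<And>q. c_lambda b q la = num q / den q" "\<And>q. \<forall>n\<ge>1. q ^ n \<noteq> 1 \<Longrightarrow> den q \<noteq> 0"
proof -
  define s where "s = length la"
  define n where "n i = la ! i + (s - 1 - i) * b" for i
  define num :: "'a \<Rightarrow> 'a" where "num q = q ^ (b * (s\<^sup>2 - (\<Sum>i\<in>set la. (Defs.mult la i)\<^sup>2)) div 2) *
     (\<Prod>i\<in>set la. qpoch (q ^ b) (q ^ b) (Defs.mult la i)) * (\<Prod>i<s. qpoch (q ^ b) q (n i))" for q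
  define den :: "'a \<Rightarrow> 'a" where "den q = (\<Prod>i\<in>set la. (1 - q ^ b) ^ Defs.mult la i) * (\<Prod>i<s. qpoch q q (n i))" for q
  have "poly_fun num" unfolding num_def
    by (intro poly_fun_mult poly_fun_prod poly_fun_qpoch poly_fun_power poly_fun_id)
  moreover have "poly_fun den" unfolding den_def
    by (intro poly_fun_mult poly_fun_prod poly_fun_qpoch poly_fun_power poly_fun_id poly_fun_diff poly_fun_const)
  moreover have "c_lambda b q la = num q / den q" for q
    by (simp add: c_lambda_def Let_def num_def den_def n_def s_def prod_dividef)
  moreover have "den q \<noteq> 0" if "\<forall>n\<ge>1. q ^ n \<noteq> 1" for q
    using that b qpoch_generic_nonzero[OF that] by (simp add: den_def)
  ultimately show thesis by (rule that)
qed

theorem theorem4p7: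
  fixes q :: "'a::field_char_0"
  shows
  "(\<forall>(\<beta>::nat list) (t::nat) (k::int list) (m::nat list).
      \<beta> \<noteq> [] \<and> t \<ge> 1 \<and> (\<forall>b\<in>set \<beta>. 0 < b) \<and>
      length k = length \<beta> \<and> length m = t \<and>
      F_coeff \<beta> t q k m \<noteq> 0
      \<longrightarrow> dominates (dec_sort k) (dec_sort (map int m)))
   \<and>
   (\<forall>(b::nat) (la::nat list).
      (\<forall>n::nat. n \<ge> 1 \<longrightarrow> q ^ n \<noteq> 1) \<and>
      0 < b \<and> is_partition la \<and> la \<noteq> []
      \<longrightarrow> F_coeff (replicate (length la) b) (length la) q (map int la) la = c_lambda b q la)"
proof (intro conjI allI impI)
  fix \<beta> :: "nat list" and t :: nat and k :: "int list" and m :: "nat list"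
  assume *: "\<beta> \<noteq> [] \<and> t \<ge> 1 \<and> (\<forall>b\<in>set \<beta>. 0 < b) \<and> length k = length \<beta> \<and> length m = t \<and>
      F_coeff \<beta> t q k m \<noteq> 0"
  obtain p :: "'a poly" where p: "\<And>q. F_coeff \<beta> t q k m = poly p q"
    using F_coeff_poly[of m t k \<beta>] * by blast
  have "p \<noteq> 0" using * p by force
  \<comment> \<open>Dominance does not mention \<open>q\<close>: a coefficient that is nonzero at
    one \<open>q\<close> is a nonzero polynomial, hence nonzero at some generic \<open>q'\<close>.
    This covers 0 and roots of unity.\<close>
  then obtain q' where "generic q'" "poly p q' \<noteq> 0" using poly_eq_0_generic[of p] by blast
  moreover from this have "F_coeff \<beta> t q' k m \<noteq> 0" by (simp add: p)
  ultimately show "dominates (dec_sort k) (dec_sort (map int m))"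
    using F_coeff_dominates_generic * by blast
next
  fix b :: nat and la :: "nat list"
  assume *: "(\<forall>n::nat. n \<ge> 1 \<longrightarrow> q ^ n \<noteq> 1) \<and> 0 < b \<and> is_partition la \<and> la \<noteq> []"
  hence q: "\<forall>n\<ge>1. q ^ n \<noteq> 1" and b: "0 < b" and la: "is_partition la" by auto
  let ?F = "\<lambda>q :: 'a. F_coeff (replicate (length la) b) (length la) q (map int la) la"
  obtain num den :: "'a \<Rightarrow> 'a" where nd: "poly_fun num" "poly_fun den"
    "\<And>q. c_lambda b q la = num q / den q" "\<And>q. \<forall>n\<ge>1. q ^ n \<noteq> 1 \<Longrightarrow> den q \<noteq> 0"
    using c_lambda_quotient[OF b] by blast
  have "poly_fun ?F" unfolding poly_fun_def by (rule F_coeff_poly) simp_all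
  hence "poly_fun (\<lambda>q. ?F q * den q - num q)" using nd by (intro poly_fun_diff poly_fun_mult)
  then obtain p where p: "\<And>q. ?F q * den q - num q = poly p q" unfolding poly_fun_def by blast
  have "poly p r = 0" if r: "generic r" for r
    using F_coeff_partition_generic[OF r b la] nd(3)[of r] nd(4)[of r] r p[of r]
    by (simp add: generic_def)
  hence "p = 0" by (rule poly_eq_0_generic)
  hence "?F q * den q = num q" using p[of q] by simp
  thus "?F q = c_lambda b q la" using nd(3) nd(4)[OF q] by (simp add: nonzero_eq_divide_eq)
qed

end
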